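(* For every finite set $\mathcal{K}$ of finite $\mathcal{L}$-algebras, the procedure $\mathrm{AdmAlgs}(\mathcal{K})$ returns the (unique up to isomorphism) minimal generating set for the quasivariety $\mathbb{Q}(\mathbf{F}_{\mathcal{K}}(\omega))$.
   Context: $\mathbb{Q}(\cdot)$ is the generated quasivariety. $\mathbf{F}_{\mathcal{K}}(m)$ is the free algebra of $\mathcal{K}$ on $m$ generators ($\mathbf{Tm}_{\mathcal{L}}(X)/\theta_{\mathcal{K}}(X)$ with $|X|=m$, $\theta_{\mathcal{K}}(X)$ the intersection of all congruences whose quotient is isomorphic to a subalgebra of a member of $\mathcal{K}$; $m=0$ is allowed when $\mathcal{L}$ has a constant); $\omega$ means countably many generators. Multiset ordering on finite multisets of naturals: $f\le_m g$ iff whenever $f(x)>g(x)$ there is $y>x$ with $g(y)>f(y)$. A finite set $\{\mathbf{A}_1,\ldots,\mathbf{A}_n\}$ of finite $\mathcal{L}$-algebras is a minimal generating set for $\mathbb{Q}(\mathbf{A}_1,\ldots,\mathbf{A}_n)$ if for every finite set of finite algebras $\{\mathbf{B}_1,\ldots,\mathbf{B}_k\}$ generating the same quasivariety, $[|A_1|,\ldots,|A_n|]\le_m[|B_1|,\ldots,|B_k|]$; for a finite set $\mathcal{M}$ of finite algebras, $\mathrm{MinGenSet}(\mathcal{M})$ denotes (a choice of) the minimal generating set of $\mathbb{Q}(\mathcal{M})$, which is unique up to isomorphism. Procedure $\mathrm{AdmAlgs}(\mathcal{K})$: let $\mathcal{D}:=\mathrm{MinGenSet}(\mathcal{K})$ and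 $\mathcal{A}:=\emptyset$. For each $\mathbf{A}\in\mathcal{D}$: let $\mathbf{B}:=\mathrm{Free}(\mathbf{A},\mathcal{D})$, the free algebra $\mathbf{F}_{\mathcal{D}}(m)$ with $m$ least (starting from $0$ if $\mathcal{L}$ has constants, otherwise from $1$) such that $\mathbf{A}$ is a homomorphic image of $\mathbf{F}_{\mathcal{D}}(m)$; then repeatedly replace $\mathbf{B}$ by $\mathrm{SubPreHom}(\mathbf{A},\mathbf{B})$ until it no longer changes, where $\mathrm{SubPreHom}(\mathbf{A},\mathbf{B})$ returns some proper subalgebra of $\mathbf{B}$ having $\mathbf{A}$ as a homomorphic image if one exists, and returns $\mathbf{B}$ otherwise; then add the final $\mathbf{B}$ to $\mathcal{A}$. Finally return $\mathrm{MinGenSet}(\mathcal{A})$. *)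

theory Defs
  imports "HOL-Library.Multiset" "HOL-Library.Multiset_Order" "HOL-Library.While_Combinator"
begin

section \<open>Languages and algebras\<close>

text \<open>A language may be empty or infinite, hence an explicit set of symbols.\<close>

record 'f language =
  symbols :: "'f set"
  arity :: "'f \<Rightarrow> nat"

definition has_constant :: "'f language \<Rightarrow> bool" where
  "has_constant L \<longleftrightarrow> (\<exists>f\<in>symbols L. arity L f = 0)"

record ('f, 'a) algebra =
  universe :: "'a set"
  oper :: "'f \<Rightarrow> 'a list \<Rightarrow> 'a"

text \<open>\<open>args L A f\<close> is the set of argument tuples of the symbol \<open>f\<close>; the values of
  \<open>oper A f\<close> outside this set are irrelevant.\<close>

definition args :: "'f language \<Rightarrow> ('f, 'a) algebra \<Rightarrow> 'f \<Rightarrow> 'a list set" where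
  "args L A f = {xs. set xs \<subseteq> universe A \<and> length xs = arity L f}"

definition is_algebra :: "'f language \<Rightarrow> ('f, 'a) algebra \<Rightarrow> bool" where
  "is_algebra L A \<longleftrightarrow> universe A \<noteq> {} \<and>
     (\<forall>f\<in>symbols L. \<forall>xs\<in>args L A f. oper A f xs \<in> universe A)"

definition is_finite_algebra :: "'f language \<Rightarrow> ('f, 'a) algebra \<Rightarrow> bool" where
  "is_finite_algebra L A \<longleftrightarrow> is_algebra L A \<and> finite (universe A)"

definition finite_algebra_set :: "'f language \<Rightarrow> ('f, 'a) algebra set \<Rightarrow> bool" where
  "finite_algebra_set L K \<longleftrightarrow> finite K \<and> (\<forall>A\<in>K. is_finite_algebra L A)"

definition homomorphism ::
    "'f language \<Rightarrow> ('f, 'a) algebra \<Rightarrow> ('f, 'b) algebra \<Rightarrow> ('a \<Rightarrow> 'b) \<Rightarrow> bool" where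
  "homomorphism L A B h \<longleftrightarrow> h ` universe A \<subseteq> universe B \<and>
     (\<forall>f\<in>symbols L. \<forall>xs\<in>args L A f. h (oper A f xs) = oper B f (map h xs))"

definition isomorphic ::
    "'f language \<Rightarrow> ('f, 'a) algebra \<Rightarrow> ('f, 'b) algebra \<Rightarrow> bool" where
  "isomorphic L A B \<longleftrightarrow> (\<exists>h. homomorphism L A B h \<and> bij_betw h (universe A) (universe B))"

definition is_homomorphic_image ::
    "'f language \<Rightarrow> ('f, 'a) algebra \<Rightarrow> ('f, 'b) algebra \<Rightarrow> bool" where
  "is_homomorphic_image L A B \<longleftrightarrow>
     (\<exists>h. homomorphism L B A h \<and> h ` universe B = universe A)"

definition subalgebra ::
    "'f language \<Rightarrow> ('f, 'a) algebra \<Rightarrow> ('f, 'a) algebra \<Rightarrow> bool" where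
  "subalgebra L C B \<longleftrightarrow> is_algebra L C \<and> universe C \<subseteq> universe B \<and>
     (\<forall>f\<in>symbols L. \<forall>xs\<in>args L C f. oper C f xs = oper B f xs)"

definition proper_subalgebra ::
    "'f language \<Rightarrow> ('f, 'a) algebra \<Rightarrow> ('f, 'a) algebra \<Rightarrow> bool" where
  "proper_subalgebra L C B \<longleftrightarrow> subalgebra L C B \<and> universe C \<noteq> universe B"

definition congruence :: "'f language \<Rightarrow> ('f, 'a) algebra \<Rightarrow> ('a \<times> 'a) set \<Rightarrow> bool" where
  "congruence L A \<theta> \<longleftrightarrow> equiv (universe A) \<theta> \<and>
     (\<forall>f\<in>symbols L. \<forall>xs\<in>args L A f. \<forall>ys\<in>args L A f.
        (\<forall>i<arity L f. (xs ! i, ys ! i) \<in> \<theta>) \<longrightarrow> (oper A f xs, oper A f ys) \<in> \<theta>)"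

definition quotient_algebra ::
    "('f, 'a) algebra \<Rightarrow> ('a \<times> 'a) set \<Rightarrow> ('f, 'a set) algebra" where
  "quotient_algebra A \<theta> =
     \<lparr>universe = universe A // \<theta>,
      oper = (\<lambda>f Cs. \<theta> `` {oper A f (map (\<lambda>C. SOME c. c \<in> C) Cs)})\<rparr>"

section \<open>Terms and free algebras\<close>

datatype ('f, 'v) trm = Var 'v | App 'f "('f, 'v) trm list"

inductive_set terms :: "'f language \<Rightarrow> 'v set \<Rightarrow> ('f, 'v) trm set"
  for L :: "'f language" and X :: "'v set" where
  Var: "x \<in> X \<Longrightarrow> Var x \<in> terms L X"
| App: "f \<in> symbols L \<Longrightarrow> length ts = arity L f \<Longrightarrow> \<forall>t\<in>set ts. t \<in> terms L X
        \<Longrightarrow> App f ts \<in> terms L X"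

definition term_algebra :: "'f language \<Rightarrow> 'v set \<Rightarrow> ('f, ('f, 'v) trm) algebra" where
  "term_algebra L X = \<lparr>universe = terms L X, oper = App\<rparr>"

text \<open>If no congruence qualifies (\<open>K = {}\<close>), the intersection is the total relation on terms.\<close>

definition free_congruence ::
    "'f language \<Rightarrow> ('f, 'a) algebra set \<Rightarrow> 'v set \<Rightarrow> (('f, 'v) trm \<times> ('f, 'v) trm) set" where
  "free_congruence L K X =
     {(s, t). s \<in> terms L X \<and> t \<in> terms L X \<and>
        (\<forall>\<theta>. congruence L (term_algebra L X) \<theta> \<and>
             (\<exists>B\<in>K. \<exists>C. subalgebra L C B \<and>
                isomorphic L (quotient_algebra (term_algebra L X) \<theta>) C)
          \<longrightarrow> (s, t) \<in> \<theta>)}"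

definition free_algebra ::
    "'f language \<Rightarrow> ('f, 'a) algebra set \<Rightarrow> 'v set \<Rightarrow> ('f, ('f, 'v) trm set) algebra" where
  "free_algebra L K X = quotient_algebra (term_algebra L X) (free_congruence L K X)"

definition free_algebra_fin ::
    "'f language \<Rightarrow> ('f, 'a) algebra set \<Rightarrow> nat \<Rightarrow> ('f, ('f, nat) trm set) algebra" where
  "free_algebra_fin L K m = free_algebra L K {..<m}"

definition free_algebra_omega ::
    "'f language \<Rightarrow> ('f, 'a) algebra set \<Rightarrow> ('f, ('f, nat) trm set) algebra" where
  "free_algebra_omega L K = free_algebra L K UNIV"

section \<open>Quasivarieties\<close>

primrec trm_value :: "('f, 'a) algebra \<Rightarrow> ('v \<Rightarrow> 'a) \<Rightarrow> ('f, 'v) trm \<Rightarrow> 'a" where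
  "trm_value A v (Var x) = v x"
| "trm_value A v (App f ts) = oper A f (map (trm_value A v) ts)"

text \<open>The pair \<open>(ps, (s, t))\<close> stands for the quasi-identity with the finite list of premises
  \<open>ps\<close> and the conclusion \<open>s \<approx> t\<close>.\<close>

type_synonym 'f quasi_identity =
  "(('f, nat) trm \<times> ('f, nat) trm) list \<times> (('f, nat) trm \<times> ('f, nat) trm)"

definition quasi_identities :: "'f language \<Rightarrow> 'f quasi_identity set" where
  "quasi_identities L =
     {(ps, e). \<forall>(s, t)\<in>insert e (set ps). s \<in> terms L UNIV \<and> t \<in> terms L UNIV}"

definition satisfies :: "('f, 'a) algebra \<Rightarrow> 'f quasi_identity \<Rightarrow> bool" where
  "satisfies A q \<longleftrightarrow>
     (\<forall>v. range v \<subseteq> universe A \<longrightarrow>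
        (\<forall>(s, t)\<in>set (fst q). trm_value A v s = trm_value A v t) \<longrightarrow>
        trm_value A v (fst (snd q)) = trm_value A v (snd (snd q)))"

definition models :: "'f language \<Rightarrow> 'f quasi_identity set \<Rightarrow> ('f, 'b) algebra set" where
  "models L \<Sigma> = {B. is_algebra L B \<and> (\<forall>q\<in>\<Sigma>. satisfies B q)}"

text \<open>The smallest class that contains \<open>K\<close> and is axiomatized by quasi-identities. The members
  of this class may live on any type \<open>'b\<close>, independently of the type of \<open>K\<close>.\<close>

definition quasivariety ::
    "'f language \<Rightarrow> ('f, 'a) algebra set \<Rightarrow> ('f, 'b) algebra set" where
  "quasivariety L K =
     {B. \<forall>\<Sigma>\<subseteq>quasi_identities L. K \<subseteq> models L \<Sigma> \<longrightarrow> B \<in> models L \<Sigma>}"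

section \<open>Minimal generating sets\<close>

definition mle :: "nat multiset \<Rightarrow> nat multiset \<Rightarrow> bool" where
  "mle f g \<longleftrightarrow> (\<forall>x. count f x > count g x \<longrightarrow> (\<exists>y>x. count g y > count f y))"

definition sizes :: "('f, 'a) algebra set \<Rightarrow> nat multiset" where
  "sizes K = image_mset (\<lambda>A. card (universe A)) (mset_set K)"

text \<open>Quasivarieties are compared through their members on sets of terms; the lemma
  \<open>quasivariety_eq_any_type\<close> below shows that this determines them on every type. A finite set of
  finite algebras has an isomorphic copy on \<open>nat\<close>, so it suffices to let the competing generating
  sets range over algebras on \<open>nat\<close>.\<close>

definition minimal_generating_set ::
    "'f language \<Rightarrow> ('f, ('f, nat) trm set) algebra set \<Rightarrow> ('f, 'a) algebra set \<Rightarrow> bool" where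
  "minimal_generating_set L Q K \<longleftrightarrow>
     finite_algebra_set L K \<and> quasivariety L K = Q \<and>
     (\<forall>M :: ('f, nat) algebra set.
        finite_algebra_set L M \<and> quasivariety L M = Q \<longrightarrow> mle (sizes K) (sizes M))"

section \<open>The procedure\<close>

text \<open>The subroutines are only specified up to a choice; the procedure is parametrized by
  arbitrary functions that meet the specifications.\<close>

definition is_MinGenSet ::
    "'f language \<Rightarrow> (('f, 'a) algebra set \<Rightarrow> ('f, 'b) algebra set) \<Rightarrow> bool" where
  "is_MinGenSet L mgs \<longleftrightarrow>
     (\<forall>M. finite_algebra_set L M \<longrightarrow> minimal_generating_set L (quasivariety L M) (mgs M))"

definition is_SubPreHom ::
    "'f language \<Rightarrow> (('f, 'a) algebra \<Rightarrow> ('f, 'b) algebra \<Rightarrow> ('f, 'b) algebra) \<Rightarrow> bool" where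
  "is_SubPreHom L sph \<longleftrightarrow>
     (\<forall>A B. is_finite_algebra L A \<longrightarrow> is_finite_algebra L B \<longrightarrow>
        (if \<exists>C. proper_subalgebra L C B \<and> is_homomorphic_image L A C
         then proper_subalgebra L (sph A B) B \<and> is_homomorphic_image L A (sph A B)
         else sph A B = B))"

definition Free ::
    "'f language \<Rightarrow> ('f, 'a) algebra \<Rightarrow> ('f, 'a) algebra set \<Rightarrow> ('f, ('f, nat) trm set) algebra"
  where
  "Free L A D =
     free_algebra_fin L D
       (LEAST m. (if has_constant L then 0 else 1) \<le> m \<and>
                 is_homomorphic_image L A (free_algebra_fin L D m))"

text \<open>The result \<open>None\<close> means that one of the loops does not terminate. The two arguments
  \<open>mgs1\<close> and \<open>mgs2\<close> stand for the same subroutine, called on algebras of different types.\<close>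

definition AdmAlgs ::
    "'f language \<Rightarrow> (('f, 'a) algebra set \<Rightarrow> ('f, 'd) algebra set)
     \<Rightarrow> (('f, 'd) algebra \<Rightarrow> ('f, ('f, nat) trm set) algebra \<Rightarrow> ('f, ('f, nat) trm set) algebra)
     \<Rightarrow> (('f, ('f, nat) trm set) algebra set \<Rightarrow> ('f, 'e) algebra set)
     \<Rightarrow> ('f, 'a) algebra set \<Rightarrow> ('f, 'e) algebra set option" where
  "AdmAlgs L mgs1 sph mgs2 K =
     (let D = mgs1 K;
          \<A> = (\<lambda>A. while_option (\<lambda>B. sph A B \<noteq> B) (sph A) (Free L A D)) ` D
      in if None \<in> \<A> then None else Some (mgs2 (the ` \<A>)))"

section \<open>Adequacy of the chosen types\<close>

lemma trm_value_in_universe: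
  assumes "is_algebra L A" "range v \<subseteq> universe A" "t \<in> terms L UNIV"
  shows "trm_value A v t \<in> universe A"
  using assms(3)
proof induction
  case (Var x)
  then show ?case using assms(2) by auto
next
  case (App f ts)
  then have "map (trm_value A v) ts \<in> args L A f" by (auto simp: args_def)
  then show ?case using assms(1) App by (auto simp: is_algebra_def)
qed

lemma homomorphism_trm_value:
  assumes "homomorphism L B A h" "is_algebra L B" "range w \<subseteq> universe B" "t \<in> terms L UNIV"
  shows "h (trm_value B w t) = trm_value A (\<lambda>x. h (w x)) t"
  using assms(4)
proof induction
  case (Var x)
  then show ?case by simp
next
  case (App f ts)
  then have "map (trm_value B w) ts \<in> args L B f"
    using trm_value_in_universe[OF assms(2,3)] by (auto simp: args_def)
  then have "h (trm_value B w (App f ts)) = oper A f (map h (map (trm_value B w) ts))"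
    using assms(1) App by (auto simp: homomorphism_def)
  also have "map h (map (trm_value B w) ts) = map (trm_value A (\<lambda>x. h (w x))) ts"
    using App by auto
  finally show ?case by simp
qed

lemma satisfies_embedding:
  assumes "homomorphism L B A h" "is_algebra L B" "inj_on h (universe B)"
    and q: "q \<in> quasi_identities L" and "satisfies A q"
  shows "satisfies B q"
  unfolding satisfies_def
proof (intro allI impI)
  fix w :: "nat \<Rightarrow> 'b"
  assume w: "range w \<subseteq> universe B"
    and prem: "\<forall>(s, t)\<in>set (fst q). trm_value B w s = trm_value B w t"
  have hw: "range (\<lambda>x. h (w x)) \<subseteq> universe A" using w assms(1) by (auto simp: homomorphism_def)
  have eq: "h (trm_value B w t) = trm_value A (\<lambda>x. h (w x)) t" if "t \<in> terms L UNIV" for t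
    by (rule homomorphism_trm_value[OF assms(1,2) w that])
  have "trm_value A (\<lambda>x. h (w x)) s = trm_value A (\<lambda>x. h (w x)) t" if "(s, t) \<in> set (fst q)" for s t
  proof -
    have "s \<in> terms L UNIV" "t \<in> terms L UNIV" using q that by (auto simp: quasi_identities_def)
    then show ?thesis using eq[of s] eq[of t] prem that by auto
  qed
  then have c: "trm_value A (\<lambda>x. h (w x)) (fst (snd q)) = trm_value A (\<lambda>x. h (w x)) (snd (snd q))"
    using assms(5) hw unfolding satisfies_def by blast
  have t: "fst (snd q) \<in> terms L UNIV" "snd (snd q) \<in> terms L UNIV"
    using q by (auto simp: quasi_identities_def)
  show "trm_value B w (fst (snd q)) = trm_value B w (snd (snd q))"
    using c eq[OF t(1)] eq[OF t(2)] t trm_value_in_universe[OF assms(2) w]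
      inj_onD[OF assms(3)] by metis
qed

lemma quasivariety_eqI:
  assumes "\<forall>A\<in>K. is_algebra L A" "\<forall>A\<in>M. is_algebra L A"
    and "\<And>q. q \<in> quasi_identities L \<Longrightarrow> (\<forall>A\<in>K. satisfies A q) \<longleftrightarrow> (\<forall>A\<in>M. satisfies A q)"
  shows "quasivariety L K = quasivariety L M"
proof -
  have "K \<subseteq> models L \<Sigma> \<longleftrightarrow> M \<subseteq> models L \<Sigma>" if "\<Sigma> \<subseteq> quasi_identities L" for \<Sigma>
    using assms that unfolding models_def by (auto; blast)
  then show ?thesis unfolding quasivariety_def by auto
qed

lemma term_model:
  fixes A :: "('f, 'a) algebra"
  assumes "is_algebra L A" "q \<in> quasi_identities L" "\<not> satisfies A q"
  obtains B :: "('f, ('f, nat) trm set) algebra" and h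
  where "is_algebra L B" "homomorphism L B A h" "inj_on h (universe B)" "\<not> satisfies B q"
proof -
  obtain v :: "nat \<Rightarrow> 'a" where v: "range v \<subseteq> universe A"
    and prem: "\<forall>(s, t)\<in>set (fst q). trm_value A v s = trm_value A v t"
    and concl: "trm_value A v (fst (snd q)) \<noteq> trm_value A v (snd (snd q))"
    using assms(3) unfolding satisfies_def by blast
  define T where "T = (terms L UNIV :: ('f, nat) trm set)"
  define \<theta> where "\<theta> = {(s, t). s \<in> T \<and> t \<in> T \<and> trm_value A v s = trm_value A v t}"
  define B where "B = quotient_algebra (term_algebra L (UNIV :: nat set)) \<theta>"
  define h where "h C = trm_value A v (SOME c. c \<in> C)" for C
  have UB: "universe B = T // \<theta>" by (simp add: B_def quotient_algebra_def term_algebra_def T_def)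
  have "C \<noteq> {} \<and> C \<subseteq> T" if "C \<in> T // \<theta>" for C
    using that by (auto simp: quotient_def \<theta>_def)
  then have rep: "(SOME c. c \<in> C) \<in> C" "C \<subseteq> T" if "C \<in> T // \<theta>" for C
    using that by (simp_all add: some_in_eq)
  have h: "h (\<theta> `` {t}) = trm_value A v t" if "t \<in> T" for t
  proof -
    have "(SOME c. c \<in> \<theta> `` {t}) \<in> \<theta> `` {t}"
      by (rule rep(1)) (use that in \<open>auto simp: quotient_def\<close>)
    then show ?thesis unfolding h_def by (auto simp: \<theta>_def)
  qed
  have AppT: "App f (map (\<lambda>C. SOME c. c \<in> C) Cs) \<in> T"
    if "f \<in> symbols L" "Cs \<in> args L B f" for f Cs
    unfolding T_def using that rep by (intro terms.App) (auto simp: args_def UB T_def)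
  have op: "oper B f Cs = \<theta> `` {App f (map (\<lambda>C. SOME c. c \<in> C) Cs)}" for f Cs
    by (simp add: B_def quotient_algebra_def term_algebra_def)
  have VarT: "Var x \<in> T" for x by (simp add: T_def terms.Var)
  have alg: "is_algebra L B"
    unfolding is_algebra_def UB using VarT AppT by (auto simp: op quotient_def)
  have hom: "homomorphism L B A h"
    unfolding homomorphism_def
  proof (intro conjI ballI)
    show "h ` universe B \<subseteq> universe A"
      using trm_value_in_universe[OF assms(1) v] h by (auto simp: UB quotient_def T_def)
  next
    fix f Cs assume "f \<in> symbols L" "Cs \<in> args L B f"
    then have "h (oper B f Cs) = trm_value A v (App f (map (\<lambda>C. SOME c. c \<in> C) Cs))"
      by (simp only: op h[OF AppT])
    then show "h (oper B f Cs) = oper A f (map h Cs)" by (simp add: o_def h_def[abs_def])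
  qed
  have inj: "inj_on h (universe B)"
  proof (rule inj_onI)
    fix C D assume "C \<in> universe B" "D \<in> universe B" and eq: "h C = h D"
    then obtain s t where st: "s \<in> T" "t \<in> T" "C = \<theta> `` {s}" "D = \<theta> `` {t}"
      by (auto simp: UB quotient_def)
    then have "trm_value A v s = trm_value A v t" using eq h by simp
    then show "C = D" using st by (auto simp: \<theta>_def)
  qed
  define w where "w = (\<lambda>x. \<theta> `` {Var x :: ('f, nat) trm})"
  have w: "range w \<subseteq> universe B" using VarT by (auto simp: w_def UB quotient_def)
  have hw: "(\<lambda>x. h (w x)) = v" by (rule ext) (simp add: w_def h VarT)
  have eq: "h (trm_value B w t) = trm_value A v t" if "t \<in> terms L UNIV" for t
    using homomorphism_trm_value[OF hom alg w that] hw by simp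
  have "\<not> satisfies B q"
  proof
    assume sat: "satisfies B q"
    have "trm_value B w s = trm_value B w t" if "(s, t) \<in> set (fst q)" for s t
    proof -
      have st: "s \<in> terms L UNIV" "t \<in> terms L UNIV"
        using assms(2) that by (auto simp: quasi_identities_def)
      then have "h (trm_value B w s) = h (trm_value B w t)" using eq prem that by auto
      then show ?thesis using inj st trm_value_in_universe[OF alg w] by (auto dest: inj_onD)
    qed
    then have "trm_value B w (fst (snd q)) = trm_value B w (snd (snd q))"
      using sat w unfolding satisfies_def by blast
    moreover have "fst (snd q) \<in> terms L UNIV" "snd (snd q) \<in> terms L UNIV"
      using assms(2) by (auto simp: quasi_identities_def)
    ultimately show False using concl eq by metis
  qed
  then show ?thesis using that alg hom inj by blast
qed

lemma quasivariety_subset_satisfies: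
  fixes K :: "('f, 'a) algebra set" and M :: "('f, 'b) algebra set"
  assumes "\<forall>A\<in>K. is_algebra L A" "\<forall>A\<in>M. is_algebra L A"
    and "(quasivariety L M :: ('f, ('f, nat) trm set) algebra set) \<subseteq> quasivariety L K"
    and q: "q \<in> quasi_identities L" and K: "\<forall>A\<in>K. satisfies A q" and "A \<in> M"
  shows "satisfies A q"
proof (rule ccontr)
  assume "\<not> satisfies A q"
  then obtain B :: "('f, ('f, nat) trm set) algebra" and h
    where B: "is_algebra L B" "homomorphism L B A h" "inj_on h (universe B)" "\<not> satisfies B q"
    using term_model assms(2) q \<open>A \<in> M\<close> by metis
  have "B \<in> quasivariety L M"
    unfolding quasivariety_def
  proof (intro CollectI allI impI)
    fix \<Sigma> assume S: "\<Sigma> \<subseteq> quasi_identities L" "M \<subseteq> models L \<Sigma>"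
    then have "satisfies A r" if "r \<in> \<Sigma>" for r using \<open>A \<in> M\<close> that by (auto simp: models_def)
    then show "B \<in> models L \<Sigma>"
      using satisfies_embedding[OF B(2,1,3)] B(1) S(1) by (auto simp: models_def)
  qed
  then have "B \<in> quasivariety L K" using assms(3) by blast
  moreover have "K \<subseteq> models L {q}" using K assms(1) by (auto simp: models_def)
  ultimately have "B \<in> models L {q}" using q unfolding quasivariety_def by blast
  then show False using B(4) by (simp add: models_def)
qed

lemma quasivariety_eq_any_type:
  fixes K :: "('f, 'a) algebra set" and M :: "('f, 'b) algebra set"
  assumes "\<forall>A\<in>K. is_algebra L A" "\<forall>A\<in>M. is_algebra L A"
    and "(quasivariety L K :: ('f, ('f, nat) trm set) algebra set) = quasivariety L M"
  shows "(quasivariety L K :: ('f, 'c) algebra set) = quasivariety L M"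
proof (rule quasivariety_eqI[OF assms(1,2)])
  fix q assume q: "q \<in> quasi_identities L"
  show "(\<forall>A\<in>K. satisfies A q) \<longleftrightarrow> (\<forall>A\<in>M. satisfies A q)"
    using quasivariety_subset_satisfies[OF assms(1,2) _ q]
      quasivariety_subset_satisfies[OF assms(2,1) _ q] assms(3) by blast
qed

lemma finite_algebra_copy:
  fixes A :: "('f, 'a) algebra"
  assumes "is_finite_algebra L A"
  shows "\<exists>N :: ('f, nat) algebra. is_finite_algebra L N \<and>
           (\<forall>q\<in>quasi_identities L. satisfies N q \<longleftrightarrow> satisfies A q)"
proof -
  let ?U = "universe A"
  obtain g where g: "bij_betw g ?U {..<card ?U}"
    using assms ex_bij_betw_finite_nat[of ?U] by (auto simp: is_finite_algebra_def atLeast0LessThan)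
  define k where "k = inv_into ?U g"
  have kg: "k (g x) = x" if "x \<in> ?U" for x
    using that g by (auto simp: k_def bij_betw_def)
  have k: "bij_betw k {..<card ?U} ?U" unfolding k_def using g by (rule bij_betw_inv_into)
  define N where "N = \<lparr>universe = {..<card ?U}, oper = (\<lambda>f ys. g (oper A f (map k ys)))\<rparr>"
  have UN: "universe N = {..<card ?U}" by (simp add: N_def)
  have op: "oper N f ys = g (oper A f (map k ys))" for f ys by (simp add: N_def)
  have ka: "map k ys \<in> args L A f" if "ys \<in> args L N f" for ys f
    using that k by (auto simp: args_def UN bij_betw_def)
  have A: "is_algebra L A" using assms by (simp add: is_finite_algebra_def)
  have opA: "oper A f xs \<in> ?U" if "f \<in> symbols L" "xs \<in> args L A f" for f xs
    using A that by (auto simp: is_algebra_def)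
  have gU: "g x \<in> universe N" if "x \<in> ?U" for x using that g by (auto simp: UN bij_betw_def)
  have N: "is_algebra L N"
    unfolding is_algebra_def using A gU opA ka
    by (auto simp: op is_algebra_def) (metis empty_iff equals0I gU)
  have h1: "homomorphism L N A k"
    unfolding homomorphism_def using k kg opA ka by (auto simp: op UN bij_betw_def)
  have h2: "homomorphism L A N g"
    unfolding homomorphism_def
  proof (intro conjI ballI)
    show "g ` ?U \<subseteq> universe N" using gU by auto
  next
    fix f xs assume "f \<in> symbols L" "xs \<in> args L A f"
    then have "map k (map g xs) = xs" by (auto simp: args_def kg subset_iff intro!: map_idI)
    then show "g (oper A f xs) = oper N f (map g xs)" by (simp add: op)
  qed
  have i: "inj_on k (universe N)" "inj_on g ?U" using k g by (auto simp: UN bij_betw_def)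
  have "\<forall>q\<in>quasi_identities L. satisfies N q \<longleftrightarrow> satisfies A q"
    using satisfies_embedding[OF h1 N i(1)] satisfies_embedding[OF h2 A i(2)] by blast
  then show ?thesis using N by (intro exI[of _ N]) (auto simp: is_finite_algebra_def UN)
qed

lemma mle_iff_le: "mle M N \<longleftrightarrow> M \<le> N"
  unfolding mle_def less_eq_multiset\<^sub>H\<^sub>O by simp

lemma ex_minimal_generating_set:
  fixes M :: "('f, 'a) algebra set"
  assumes "finite_algebra_set L M"
  shows "\<exists>N :: ('f, nat) algebra set. minimal_generating_set L (quasivariety L M) N"
proof -
  let ?Q = "quasivariety L M :: ('f, ('f, nat) trm set) algebra set"
  define P where "P N \<longleftrightarrow> finite_algebra_set L N \<and> quasivariety L N = ?Q"
    for N :: "('f, nat) algebra set"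
  have "\<forall>A\<in>M. \<exists>N :: ('f, nat) algebra. is_finite_algebra L N \<and>
          (\<forall>q\<in>quasi_identities L. satisfies N q \<longleftrightarrow> satisfies A q)"
    using finite_algebra_copy assms unfolding finite_algebra_set_def by blast
  then obtain c :: "('f, 'a) algebra \<Rightarrow> ('f, nat) algebra" where
    c: "\<And>A. A \<in> M \<Longrightarrow> is_finite_algebra L (c A) \<and>
          (\<forall>q\<in>quasi_identities L. satisfies (c A) q \<longleftrightarrow> satisfies A q)"
    by (auto dest!: bchoice)
  have "quasivariety L (c ` M) = ?Q"
    by (rule quasivariety_eqI)
       (use c assms in \<open>auto simp: finite_algebra_set_def is_finite_algebra_def\<close>)
  then have "P (c ` M)" using c assms by (auto simp: P_def finite_algebra_set_def)
  then have "\<exists>s N. P N \<and> sizes N = s" by blast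
  then obtain N where N: "P N" "\<And>N'. P N' \<Longrightarrow> \<not> sizes N' < sizes N"
    unfolding exists_least_iff[of "\<lambda>s. \<exists>N. P N \<and> sizes N = s"] by blast
  have "mle (sizes N) (sizes N')" if "P N'" for N'
    using N(2)[OF that] by (simp add: mle_iff_le not_less)
  then have "minimal_generating_set L ?Q N"
    using N(1) by (auto simp: minimal_generating_set_def P_def)
  then show ?thesis by blast
qed

text \<open>The specifications of the subroutines can be met.\<close>

lemma ex_MinGenSet:
  "\<exists>mgs :: ('f, 'a) algebra set \<Rightarrow> ('f, nat) algebra set. is_MinGenSet L mgs"
  unfolding is_MinGenSet_def using ex_minimal_generating_set by metis

lemma ex_SubPreHom:
  "\<exists>sph :: ('f, 'a) algebra \<Rightarrow> ('f, 'b) algebra \<Rightarrow> ('f, 'b) algebra. is_SubPreHom L sph"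
proof -
  let ?P = "\<lambda>(A :: ('f, 'a) algebra) (B :: ('f, 'b) algebra) C.
              proper_subalgebra L C B \<and> is_homomorphic_image L A C"
  have "is_SubPreHom L (\<lambda>A B. if \<exists>C. ?P A B C then SOME C. ?P A B C else B)"
    unfolding is_SubPreHom_def
  proof (intro allI impI)
    fix A :: "('f, 'a) algebra" and B :: "('f, 'b) algebra"
    show "if \<exists>C. ?P A B C
          then ?P A B (if \<exists>C. ?P A B C then SOME C. ?P A B C else B)
          else (if \<exists>C. ?P A B C then SOME C. ?P A B C else B) = B"
    proof (cases "\<exists>C. ?P A B C")
      case True
      from someI_ex[OF this] True show ?thesis by (simp only: if_True)
    next
      case False
      then show ?thesis by (simp only: if_False)
    qed
  qed
  then show ?thesis by blast
qed

end

theory Submission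
  imports Defs "HOL-Library.FuncSet"
begin

text \<open>Let \<open>D\<close> be the minimal generating set of \<open>Q(K)\<close> and let \<open>F A\<close> be the algebra found for
  \<open>A \<in> D\<close>. As a subalgebra of \<open>F\<^sub>D(m)\<close>, it embeds into \<open>F\<^sub>D(\<omega>) = F\<^sub>K(\<omega>)\<close>. Conversely, points of
  \<open>F\<^sub>D(\<omega>)\<close> are separated by homomorphisms into members \<open>A\<close> of \<open>D\<close>, and by freeness these factor
  through \<open>F A \<rightarrow> A\<close>; so points are separated by homomorphisms into the \<open>F A\<close>, and the two sides
  have the same quasi-identities. For uniqueness, a finite algebra in \<open>Q(R')\<close>, with \<open>R'\<close> a finite
  set of finite algebras, is separated by homomorphisms into \<open>R'\<close>. If none of them is injective on
  \<open>A \<in> R\<close>, then replacing \<open>A\<close> by its images decreases the multiset of sizes. Hence the members of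
  two minimal generating sets embed into each other, and since a minimal generating set is an
  antichain under embeddings, these embeddings are isomorphisms.\<close>

section \<open>Homomorphisms, subalgebras and quotients\<close>

lemma homomorphism_in: "homomorphism L A B h \<Longrightarrow> x \<in> universe A \<Longrightarrow> h x \<in> universe B"
  by (auto simp: homomorphism_def)

lemma homomorphism_oper:
  "homomorphism L A B h \<Longrightarrow> f \<in> symbols L \<Longrightarrow> xs \<in> args L A f
    \<Longrightarrow> h (oper A f xs) = oper B f (map h xs)"
  by (simp add: homomorphism_def)

lemma homomorphism_args: "homomorphism L A B h \<Longrightarrow> xs \<in> args L A f \<Longrightarrow> map h xs \<in> args L B f"
  by (auto simp: args_def intro: homomorphism_in)

lemma homomorphism_comp:
  assumes "homomorphism L A B g" "homomorphism L B C h"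
  shows "homomorphism L A C (h \<circ> g)"
  unfolding homomorphism_def
proof (intro conjI ballI)
  show "(h \<circ> g) ` universe A \<subseteq> universe C"
    using assms by (auto intro: homomorphism_in)
next
  fix f xs assume "f \<in> symbols L" "xs \<in> args L A f"
  then show "(h \<circ> g) (oper A f xs) = oper C f (map (h \<circ> g) xs)"
    using homomorphism_oper[OF assms(1)] homomorphism_oper[OF assms(2)] homomorphism_args[OF assms(1)]
    by simp
qed

text \<open>\<open>subalgebra\<close> relates algebras on one type by inclusion; an embedding
  expresses the same up to isomorphism, also between algebras on different types.\<close>

definition embeds :: "'f language \<Rightarrow> ('f, 'a) algebra \<Rightarrow> ('f, 'b) algebra \<Rightarrow> bool" where
  "embeds L A B \<longleftrightarrow> (\<exists>h. homomorphism L A B h \<and> inj_on h (universe A))"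

lemma embeds_trans: "embeds L A B \<Longrightarrow> embeds L B C \<Longrightarrow> embeds L A C"
  unfolding embeds_def
  by (metis homomorphism_comp comp_inj_on inj_on_subset homomorphism_def)

lemma satisfies_embeds:
  "embeds L A B \<Longrightarrow> is_algebra L A \<Longrightarrow> q \<in> quasi_identities L \<Longrightarrow> satisfies B q \<Longrightarrow> satisfies A q"
  unfolding embeds_def using satisfies_embedding by blast

lemma embeds_card_le:
  "embeds L A B \<Longrightarrow> finite (universe B) \<Longrightarrow> card (universe A) \<le> card (universe B)"
  by (auto simp: embeds_def homomorphism_def intro: card_inj_on_le)

lemma embeds_imp_isomorphic:
  assumes "embeds L A B" "finite (universe B)" "card (universe B) \<le> card (universe A)"
  shows "isomorphic L A B"
proof -
  obtain h where h: "homomorphism L A B h" "inj_on h (universe A)"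
    using assms(1) by (auto simp: embeds_def)
  have "h ` universe A = universe B"
    using h assms(2,3) by (intro card_seteq) (auto simp: homomorphism_def card_image)
  then show ?thesis using h by (auto simp: isomorphic_def bij_betw_def)
qed

lemma subalgebra_embeds: "subalgebra L C B \<Longrightarrow> embeds L C B"
  unfolding embeds_def by (rule exI[of _ id]) (auto simp: subalgebra_def homomorphism_def)

lemma subalgebra_refl: "is_algebra L A \<Longrightarrow> subalgebra L A A"
  by (simp add: subalgebra_def)

lemma subalgebra_trans: "subalgebra L A B \<Longrightarrow> subalgebra L B C \<Longrightarrow> subalgebra L A C"
  unfolding subalgebra_def args_def by fastforce

lemma is_algebra_oper:
  "is_algebra L A \<Longrightarrow> f \<in> symbols L \<Longrightarrow> xs \<in> args L A f \<Longrightarrow> oper A f xs \<in> universe A"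
  by (auto simp: is_algebra_def)

text \<open>Arguments taken from the image are pulled back to \<open>A\<close>, where the operation
  stays inside the universe.\<close>

lemma subalgebra_image:
  assumes "homomorphism L A B h" "is_algebra L A"
  shows "subalgebra L \<lparr>universe = h ` universe A, oper = oper B\<rparr> B"
proof -
  have "oper B f ys \<in> h ` universe A"
    if f: "f \<in> symbols L" and ys: "set ys \<subseteq> h ` universe A" "length ys = arity L f" for f ys
  proof -
    define xs where "xs = map (inv_into (universe A) h) ys"
    have xs: "xs \<in> args L A f" "map h xs = ys"
      using ys by (auto simp: xs_def args_def subset_iff inv_into_into f_inv_into_f intro!: map_idI)
    then show ?thesis
      using homomorphism_oper[OF assms(1) f xs(1)] is_algebra_oper[OF assms(2) f xs(1)]
      by (metis imageI)
  qed
  then show ?thesis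
    using assms by (auto simp: subalgebra_def is_algebra_def args_def homomorphism_def)
qed

text \<open>Competing generating sets in \<open>minimal_generating_set\<close> live on
  \<open>nat\<close>, so comparisons pass through copies. Beyond what
  \<open>finite_algebra_copy\<close> provides, the cardinality and embeddings in both directions are
  recorded.\<close>

lemma isomorphic_nat_copy:
  fixes A :: "('f, 'a) algebra"
  assumes "is_finite_algebra L A"
  shows "\<exists>N :: ('f, nat) algebra. is_finite_algebra L N \<and> card (universe N) = card (universe A) \<and>
           embeds L A N \<and> embeds L N A"
proof -
  let ?U = "universe A"
  have A: "is_algebra L A" "finite ?U" using assms by (auto simp: is_finite_algebra_def)
  obtain g :: "'a \<Rightarrow> nat" where g: "inj_on g ?U"
    using finite_imp_inj_to_nat_seg[OF A(2)] by blast
  define k where "k = inv_into ?U g"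
  define N where "N = \<lparr>universe = g ` ?U, oper = (\<lambda>f ys. g (oper A f (map k ys)))\<rparr>"
  have kg: "k (g x) = x" if "x \<in> ?U" for x using that g by (simp add: k_def)
  have ka: "map k ys \<in> args L A f" if "ys \<in> args L N f" for ys f
    using that kg by (auto simp: args_def N_def)
  have N: "is_algebra L N"
    using A(1) is_algebra_oper[OF A(1) _ ka] by (auto simp: is_algebra_def N_def)
  have "homomorphism L N A k"
    using is_algebra_oper[OF A(1) _ ka] kg by (auto simp: homomorphism_def N_def)
  moreover have "inj_on k (universe N)" using kg by (auto simp: inj_on_def N_def)
  moreover have "homomorphism L A N g"
    unfolding homomorphism_def
  proof (intro conjI ballI)
    show "g ` ?U \<subseteq> universe N" by (simp add: N_def)
  next
    fix f xs assume "f \<in> symbols L" "xs \<in> args L A f"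
    then have "map k (map g xs) = xs" by (auto simp: args_def kg subset_iff intro!: map_idI)
    then show "g (oper A f xs) = oper N f (map g xs)" by (simp add: N_def)
  qed
  ultimately show ?thesis
    using N A(2) g by (intro exI[of _ N]) (auto simp: is_finite_algebra_def embeds_def N_def card_image)
qed

section \<open>Quotients and the homomorphism theorem\<close>

text \<open>\<open>quotient_algebra\<close> evaluates an operation at representatives picked by
  \<open>SOME\<close>; compatibility of \<open>\<theta>\<close> makes the result independent of the
  choice.\<close>

lemma quotient_oper:
  assumes "is_algebra L A" "congruence L A \<theta>" "f \<in> symbols L" "xs \<in> args L A f"
  shows "oper (quotient_algebra A \<theta>) f (map (\<lambda>x. \<theta> `` {x}) xs) = \<theta> `` {oper A f xs}"
proof -
  have eq: "equiv (universe A) \<theta>" using assms(2) by (simp add: congruence_def)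
  define ys where "ys = map (\<lambda>x. SOME c. c \<in> \<theta> `` {x}) xs"
  have rep: "(x, SOME c. c \<in> \<theta> `` {x}) \<in> \<theta>" if "x \<in> universe A" for x
    using someI[of "\<lambda>c. c \<in> \<theta> `` {x}" x] equiv_class_self[OF eq that] by simp
  have sub: "\<theta> \<subseteq> universe A \<times> universe A" using eq by (rule equiv_type)
  have xs: "set xs \<subseteq> universe A" "length xs = arity L f" using assms(4) by (auto simp: args_def)
  have "ys \<in> args L A f" using xs rep sub by (auto simp: ys_def args_def)
  moreover have "\<forall>i<arity L f. (xs ! i, ys ! i) \<in> \<theta>"
    using xs rep nth_mem[of _ xs] by (auto simp: ys_def subset_iff simp del: Image_singleton_iff)
  ultimately have "(oper A f xs, oper A f ys) \<in> \<theta>"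
    using assms(2-4) by (auto simp: congruence_def)
  then show ?thesis
    using equiv_class_eq[OF eq] by (simp add: quotient_algebra_def ys_def o_def)
qed

lemma quotient_map_homomorphism:
  assumes "is_algebra L A" "congruence L A \<theta>"
  shows "homomorphism L A (quotient_algebra A \<theta>) (\<lambda>x. \<theta> `` {x})"
  using quotient_oper[OF assms]
  by (auto simp: homomorphism_def quotient_algebra_def quotientI)

text \<open>Choosing representatives brings any tuple of classes into the form to which
  \<open>quotient_oper\<close> applies.\<close>

lemma quotient_args:
  assumes "Cs \<in> args L (quotient_algebra A \<theta>) f"
  obtains xs where "xs \<in> args L A f" "Cs = map (\<lambda>x. \<theta> `` {x}) xs"
proof -
  have "\<forall>C\<in>set Cs. \<exists>x. x \<in> universe A \<and> C = \<theta> `` {x}"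
    using assms by (auto simp: args_def quotient_algebra_def quotient_def)
  then obtain r where r: "\<And>C. C \<in> set Cs \<Longrightarrow> r C \<in> universe A \<and> C = \<theta> `` {r C}" by metis
  show ?thesis
  proof (rule that)
    show "map r Cs \<in> args L A f" using assms r by (auto simp: args_def)
    show "Cs = map (\<lambda>x. \<theta> `` {x}) (map r Cs)" using r by (auto intro!: map_idI[symmetric])
  qed
qed

lemma quotient_is_algebra:
  assumes "is_algebra L A" "congruence L A \<theta>"
  shows "is_algebra L (quotient_algebra A \<theta>)"
  unfolding is_algebra_def
proof (intro conjI ballI)
  show "universe (quotient_algebra A \<theta>) \<noteq> {}"
    using assms(1) by (auto simp: is_algebra_def quotient_algebra_def quotient_def)
next
  fix f Cs assume f: "f \<in> symbols L" and "Cs \<in> args L (quotient_algebra A \<theta>) f"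
  then obtain xs where "xs \<in> args L A f" "Cs = map (\<lambda>x. \<theta> `` {x}) xs"
    by (elim quotient_args)
  then show "oper (quotient_algebra A \<theta>) f Cs \<in> universe (quotient_algebra A \<theta>)"
    using quotient_oper[OF assms f] is_algebra_oper[OF assms(1) f]
    by (simp add: quotient_algebra_def quotientI)
qed

text \<open>The homomorphism theorem: \<open>k\<close> is evaluated at a chosen representative, and
  by \<open>ker\<close> the choice does not matter.\<close>

lemma quotient_lift:
  assumes A: "is_algebra L A" "congruence L A \<theta>" and k: "homomorphism L A B k"
    and ker: "\<And>x y. (x, y) \<in> \<theta> \<Longrightarrow> k x = k y"
  obtains h where "homomorphism L (quotient_algebra A \<theta>) B h"
    "\<And>x. x \<in> universe A \<Longrightarrow> h (\<theta> `` {x}) = k x"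
proof -
  have eq: "equiv (universe A) \<theta>" using A(2) by (simp add: congruence_def)
  define h where "h C = k (SOME c. c \<in> C)" for C
  have h: "h (\<theta> `` {x}) = k x" if "x \<in> universe A" for x
  proof -
    have "(x, SOME c. c \<in> \<theta> `` {x}) \<in> \<theta>"
      using someI[of "\<lambda>c. c \<in> \<theta> `` {x}" x] equiv_class_self[OF eq that] by simp
    then show ?thesis using ker by (simp add: h_def)
  qed
  have "homomorphism L (quotient_algebra A \<theta>) B h"
    unfolding homomorphism_def
  proof (intro conjI ballI)
    show "h ` universe (quotient_algebra A \<theta>) \<subseteq> universe B"
      using h homomorphism_in[OF k] by (auto simp: quotient_algebra_def quotient_def)
  next
    fix f Cs assume f: "f \<in> symbols L" and "Cs \<in> args L (quotient_algebra A \<theta>) f"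
    then obtain xs where xs: "xs \<in> args L A f" "Cs = map (\<lambda>x. \<theta> `` {x}) xs"
      by (elim quotient_args)
    have "map h Cs = map k xs" using xs h by (auto simp: args_def)
    then show "h (oper (quotient_algebra A \<theta>) f Cs) = oper B f (map h Cs)"
      using quotient_oper[OF A f xs(1)] h[OF is_algebra_oper[OF A(1) f xs(1)]]
        homomorphism_oper[OF k f xs(1)] by (simp only: xs(2))
  qed
  then show ?thesis using that h by blast
qed

section \<open>Free algebras\<close>

lemma terms_mono: "t \<in> terms L X \<Longrightarrow> X \<subseteq> Y \<Longrightarrow> t \<in> terms L Y"
  by (induction rule: terms.induct) (auto intro: terms.intros)

lemma trm_value_cong:
  "t \<in> terms L X \<Longrightarrow> (\<And>x. x \<in> X \<Longrightarrow> v x = w x) \<Longrightarrow> trm_value A v t = trm_value A w t"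
proof (induction rule: terms.induct)
  case (App f ts)
  then have "map (trm_value A v) ts = map (trm_value A w) ts" by auto
  then show ?case by (simp only: trm_value.simps)
qed simp

lemma term_algebra_is_algebra: "terms L X \<noteq> {} \<Longrightarrow> is_algebra L (term_algebra L X)"
  by (auto simp: is_algebra_def term_algebra_def args_def intro!: terms.App)

lemma trm_value_homomorphism:
  assumes "is_algebra L A" "range v \<subseteq> universe A"
  shows "homomorphism L (term_algebra L X) A (trm_value A v)"
  using trm_value_in_universe[OF assms] terms_mono[of _ L X UNIV]
  by (auto simp: homomorphism_def term_algebra_def)

text \<open>The variables generate the term algebra. Since \<open>v\<close> is constrained only on
  \<open>X\<close>, any total extension of the values at the variables will do.\<close>

lemma term_homomorphism_eq:
  assumes h: "homomorphism L (term_algebra L X) A h" and v: "\<And>x. x \<in> X \<Longrightarrow> v x = h (Var x)"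
    and "t \<in> terms L X"
  shows "h t = trm_value A v t"
  using assms(3)
proof (induction rule: terms.induct)
  case (App f ts)
  then have "ts \<in> args L (term_algebra L X) f" by (auto simp: args_def term_algebra_def)
  then have "h (App f ts) = oper A f (map h ts)"
    using homomorphism_oper[OF h] App by (simp add: term_algebra_def)
  moreover have "map h ts = map (trm_value A v) ts" using App by auto
  ultimately show ?case by simp
qed (simp add: v)

lemma kernel_congruence:
  assumes "homomorphism L A B h" "is_algebra L A"
  shows "congruence L A {(x, y). x \<in> universe A \<and> y \<in> universe A \<and> h x = h y}"
proof -
  let ?\<theta> = "{(x, y). x \<in> universe A \<and> y \<in> universe A \<and> h x = h y}"
  have "(oper A f xs, oper A f ys) \<in> ?\<theta>"
    if f: "f \<in> symbols L" and xs: "xs \<in> args L A f" and ys: "ys \<in> args L A f"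
      and eq: "\<forall>i<arity L f. (xs ! i, ys ! i) \<in> ?\<theta>" for f xs ys
  proof -
    have "map h xs = map h ys" using xs ys eq by (auto simp: args_def intro!: nth_equalityI)
    then have "h (oper A f xs) = h (oper A f ys)"
      by (simp only: homomorphism_oper[OF assms(1) f xs] homomorphism_oper[OF assms(1) f ys])
    then show ?thesis using is_algebra_oper[OF assms(2) f xs] is_algebra_oper[OF assms(2) f ys] by simp
  qed
  moreover have "equiv (universe A) ?\<theta>" by (auto simp: equiv_def refl_on_def sym_def trans_def)
  ultimately show ?thesis unfolding congruence_def by blast
qed

section \<open>The free congruence as a set of identities\<close>

text \<open>The congruences intersected in \<open>free_congruence\<close> are exactly the kernels of
  homomorphisms from the term algebra into members of \<open>K\<close>, and these homomorphisms are
  evaluations under valuations. Hence the intersection consists of the identities over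
  \<open>X\<close> valid in \<open>K\<close>.\<close>

lemma free_congruence_iff:
  fixes X :: "nat set"
  assumes K: "\<forall>A\<in>K. is_algebra L A"
  shows "(s, t) \<in> free_congruence L K X \<longleftrightarrow>
    s \<in> terms L X \<and> t \<in> terms L X \<and> (\<forall>A\<in>K. satisfies A ([], (s, t)))"
proof
  assume st: "(s, t) \<in> free_congruence L K X"
  then have T: "s \<in> terms L X" "t \<in> terms L X" by (auto simp: free_congruence_def)
  let ?T = "term_algebra L X"
  have TA: "is_algebra L ?T" using T by (intro term_algebra_is_algebra) auto
  have "trm_value A v s = trm_value A v t" if "A \<in> K" "range v \<subseteq> universe A" for A v
  proof -
    let ?h = "trm_value A v"
    have A: "is_algebra L A" using K that by blast
    have h: "homomorphism L ?T A ?h" by (rule trm_value_homomorphism[OF A that(2)])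
    \<comment> \<open>The quotient by this kernel is isomorphic to the image \<open>C\<close> of
      \<open>?h\<close>, a subalgebra of \<open>A\<close>, so \<open>\<theta>\<close> is one of the
      intersected congruences.\<close>
    define \<theta> where "\<theta> = {(x, y). x \<in> universe ?T \<and> y \<in> universe ?T \<and> ?h x = ?h y}"
    have cong: "congruence L ?T \<theta>" unfolding \<theta>_def by (rule kernel_congruence[OF h TA])
    define C where "C = \<lparr>universe = ?h ` universe ?T, oper = oper A\<rparr>"
    have C: "subalgebra L C A" unfolding C_def by (rule subalgebra_image[OF h TA])
    have hC: "homomorphism L ?T C ?h" using h by (auto simp: homomorphism_def C_def)
    obtain k where k: "homomorphism L (quotient_algebra ?T \<theta>) C k"
      "\<And>x. x \<in> universe ?T \<Longrightarrow> k (\<theta> `` {x}) = ?h x"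
      by (rule quotient_lift[OF TA cong hC]) (auto simp: \<theta>_def)
    have "bij_betw k (universe (quotient_algebra ?T \<theta>)) (universe C)"
      unfolding bij_betw_def
    proof
      show "inj_on k (universe (quotient_algebra ?T \<theta>))"
      proof (rule inj_onI)
        fix P Q assume PQ: "P \<in> universe (quotient_algebra ?T \<theta>)"
          "Q \<in> universe (quotient_algebra ?T \<theta>)" "k P = k Q"
        then obtain x y where "x \<in> universe ?T" "y \<in> universe ?T" "P = \<theta> `` {x}" "Q = \<theta> `` {y}"
          by (auto simp: quotient_algebra_def quotient_def)
        then show "P = Q" using k(2) PQ(3) by (auto simp: \<theta>_def)
      qed
      have "k ` universe (quotient_algebra ?T \<theta>) = (\<lambda>x. k (\<theta> `` {x})) ` universe ?T"
        by (auto simp: quotient_algebra_def quotient_def)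
      then show "k ` universe (quotient_algebra ?T \<theta>) = universe C"
        using k(2) by (simp add: C_def)
    qed
    then have "isomorphic L (quotient_algebra ?T \<theta>) C" using k(1) by (auto simp: isomorphic_def)
    then have "(s, t) \<in> \<theta>"
      using st cong C \<open>A \<in> K\<close> by (auto simp: free_congruence_def)
    then show ?thesis by (simp add: \<theta>_def)
  qed
  then show "s \<in> terms L X \<and> t \<in> terms L X \<and> (\<forall>A\<in>K. satisfies A ([], (s, t)))"
    using T by (auto simp: satisfies_def)
next
  assume st: "s \<in> terms L X \<and> t \<in> terms L X \<and> (\<forall>A\<in>K. satisfies A ([], (s, t)))"
  let ?T = "term_algebra L X"
  have TA: "is_algebra L ?T" using st by (intro term_algebra_is_algebra) auto
  have UT: "universe ?T = terms L X" by (simp add: term_algebra_def)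
  have "(s, t) \<in> \<theta>" if cong: "congruence L ?T \<theta>" and "B \<in> K" and C: "subalgebra L C B"
    and iso: "isomorphic L (quotient_algebra ?T \<theta>) C" for \<theta> B C
  proof -
    obtain j where j: "homomorphism L (quotient_algebra ?T \<theta>) C j"
      and inj: "inj_on j (universe (quotient_algebra ?T \<theta>))"
      using iso by (auto simp: isomorphic_def bij_betw_def)
    have jB: "homomorphism L (quotient_algebra ?T \<theta>) B j"
      unfolding homomorphism_def
    proof (intro conjI ballI)
      show "j ` universe (quotient_algebra ?T \<theta>) \<subseteq> universe B"
        using j C by (auto simp: homomorphism_def subalgebra_def)
    next
      fix f xs assume "f \<in> symbols L" "xs \<in> args L (quotient_algebra ?T \<theta>) f"
      then show "j (oper (quotient_algebra ?T \<theta>) f xs) = oper B f (map j xs)"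
        using homomorphism_oper[OF j] homomorphism_args[OF j] C by (auto simp: subalgebra_def)
    qed
    define k where "k = j \<circ> (\<lambda>x. \<theta> `` {x})"
    have k: "homomorphism L ?T B k"
      unfolding k_def by (rule homomorphism_comp[OF quotient_map_homomorphism[OF TA cong] jB])
    \<comment> \<open>A valuation must be total and stay inside \<open>B\<close>; variables outside
      \<open>X\<close> get the value \<open>k s\<close>, which is available even when
      \<open>X\<close> is empty.\<close>
    define v where "v x = (if x \<in> X then k (Var x) else k s)" for x
    have "range v \<subseteq> universe B"
      using homomorphism_in[OF k] st by (auto simp: v_def UT terms.Var)
    then have "trm_value B v s = trm_value B v t"
      using st \<open>B \<in> K\<close> by (auto simp: satisfies_def)
    then have "k s = k t"
      using term_homomorphism_eq[OF k, of v] st by (simp add: v_def)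
    then have "\<theta> `` {s} = \<theta> `` {t}"
      using inj st by (auto simp: k_def inj_on_def quotient_algebra_def UT quotientI)
    then show ?thesis
      using cong st eq_equiv_class[of \<theta> s t "universe ?T"] by (auto simp: congruence_def UT)
  qed
  then show "(s, t) \<in> free_congruence L K X" using st by (auto simp: free_congruence_def)
qed

lemma satisfies_identity_iff:
  "satisfies A ([], (s, t)) \<longleftrightarrow> (\<forall>v. range v \<subseteq> universe A \<longrightarrow> trm_value A v s = trm_value A v t)"
  by (simp add: satisfies_def)

text \<open>By \<open>free_congruence_iff\<close>, related terms are those with equal values under
  all valuations in members of \<open>K\<close>, and equality of values is preserved by forming
  \<open>App\<close>.\<close>

lemma free_congruence_congruence:
  fixes X :: "nat set" and K :: "('f, 'a) algebra set"
  assumes K: "\<forall>A\<in>K. is_algebra L A"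
  shows "congruence L (term_algebra L X) (free_congruence L K X)"
proof -
  have "trm_value A v (App f xs) = trm_value A v (App f ys)"
    if "length xs = length ys" "\<forall>i<length xs. trm_value A v (xs ! i) = trm_value A v (ys ! i)"
    for A :: "('f, 'a) algebra" and v and f :: 'f and xs ys :: "('f, nat) trm list"
  proof -
    have "map (trm_value A v) xs = map (trm_value A v) ys"
      using that by (auto intro!: nth_equalityI)
    then show ?thesis by simp
  qed
  then show ?thesis
    unfolding congruence_def
    by (auto simp: equiv_def refl_on_def sym_def trans_def free_congruence_iff[OF K] args_def
        term_algebra_def satisfies_identity_iff simp del: trm_value.simps intro!: terms.App)
qed

lemma free_algebra_universe:
  "universe (free_algebra L K X) = (\<lambda>t. free_congruence L K X `` {t}) ` terms L X"
  by (auto simp: free_algebra_def quotient_algebra_def quotient_def term_algebra_def)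

lemma free_algebra_class_eq_iff:
  fixes X :: "nat set"
  assumes "\<forall>A\<in>K. is_algebra L A" "s \<in> terms L X" "t \<in> terms L X"
  shows "free_congruence L K X `` {s} = free_congruence L K X `` {t} \<longleftrightarrow>
    (\<forall>A\<in>K. satisfies A ([], (s, t)))"
proof -
  have "equiv (terms L X) (free_congruence L K X)"
    using free_congruence_congruence[OF assms(1), of X] by (simp add: congruence_def term_algebra_def)
  then show ?thesis
    using eq_equiv_class_iff[of "terms L X"] assms(2,3) free_congruence_iff[OF assms(1)] by blast
qed

section \<open>Universal property, separation and size of free algebras\<close>

lemma free_algebra_is_algebra:
  fixes X :: "nat set"
  assumes "\<forall>A\<in>K. is_algebra L A" "terms L X \<noteq> {}"
  shows "is_algebra L (free_algebra L K X)"
  unfolding free_algebra_def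
  by (rule quotient_is_algebra[OF term_algebra_is_algebra[OF assms(2)]
        free_congruence_congruence[OF assms(1)]])

text \<open>The universal property: evaluation under \<open>w\<close> is constant on classes as soon
  as \<open>B\<close> satisfies the identities of \<open>K\<close> in the variables
  \<open>X\<close>. Thus \<open>B\<close> may lie outside \<open>K\<close>, as the targets
  \<open>F A\<close> do later.\<close>

lemma free_algebra_lift:
  fixes X :: "nat set"
  assumes K: "\<forall>A\<in>K. is_algebra L A" and X: "terms L X \<noteq> {}"
    and B: "is_algebra L B" "range w \<subseteq> universe B"
    and id: "\<And>s t. s \<in> terms L X \<Longrightarrow> t \<in> terms L X \<Longrightarrow> \<forall>A\<in>K. satisfies A ([], (s, t))
              \<Longrightarrow> satisfies B ([], (s, t))"
  obtains k where "homomorphism L (free_algebra L K X) B k"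
    "\<And>t. t \<in> terms L X \<Longrightarrow> k (free_congruence L K X `` {t}) = trm_value B w t"
proof -
  have "trm_value B w s = trm_value B w t" if "(s, t) \<in> free_congruence L K X" for s t
    using that id[of s t] B(2) unfolding free_congruence_iff[OF K] satisfies_identity_iff by blast
  then show ?thesis
    using quotient_lift[OF term_algebra_is_algebra[OF X] free_congruence_congruence[OF K]
        trm_value_homomorphism[OF B]] that
    unfolding free_algebra_def by (metis (lifting) select_convs(1) term_algebra_def)
qed

text \<open>Distinct classes come from an identity that fails in some \<open>A\<close>, and the
  refuting valuation \<open>w\<close> induces the separating homomorphism. The formula for
  \<open>k\<close> in terms of \<open>w\<close> is what later allows lifting it along a
  surjection.\<close>

lemma free_algebra_separation:
  fixes X :: "nat set"
  assumes K: "\<forall>A\<in>K. is_algebra L A"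
    and ab: "a \<in> universe (free_algebra L K X)" "b \<in> universe (free_algebra L K X)" "a \<noteq> b"
  obtains A w k where "A \<in> K" "range w \<subseteq> universe A" "homomorphism L (free_algebra L K X) A k"
    "\<And>t. t \<in> terms L X \<Longrightarrow> k (free_congruence L K X `` {t}) = trm_value A w t" "k a \<noteq> k b"
proof -
  obtain s t where st: "s \<in> terms L X" "t \<in> terms L X"
    "a = free_congruence L K X `` {s}" "b = free_congruence L K X `` {t}"
    using ab by (auto simp: free_algebra_universe)
  obtain A w where A: "A \<in> K" "range w \<subseteq> universe A" "trm_value A w s \<noteq> trm_value A w t"
    using free_algebra_class_eq_iff[OF K st(1,2)] st ab(3) satisfies_identity_iff by metis
  obtain k where "homomorphism L (free_algebra L K X) A k"
    "\<And>t. t \<in> terms L X \<Longrightarrow> k (free_congruence L K X `` {t}) = trm_value A w t"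
    using free_algebra_lift[of K L X A w] K st(1) A by blast
  then show ?thesis using that[of A w k] A st by simp
qed

text \<open>By separation, a failure of the identity would survive a homomorphism into some member
  of \<open>K\<close>, where the identity holds.\<close>

lemma free_algebra_satisfies_identity:
  fixes X :: "nat set"
  assumes K: "\<forall>A\<in>K. is_algebra L A" and X: "terms L X \<noteq> {}"
    and st: "s \<in> terms L UNIV" "t \<in> terms L UNIV" and id: "\<forall>A\<in>K. satisfies A ([], (s, t))"
  shows "satisfies (free_algebra L K X) ([], (s, t))"
  unfolding satisfies_identity_iff
proof (intro allI impI)
  let ?F = "free_algebra L K X"
  have F: "is_algebra L ?F" by (rule free_algebra_is_algebra[OF K X])
  fix v :: "nat \<Rightarrow> _" assume v: "range v \<subseteq> universe ?F"
  show "trm_value ?F v s = trm_value ?F v t"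
  proof (rule ccontr)
    assume "trm_value ?F v s \<noteq> trm_value ?F v t"
    then obtain A k where A: "A \<in> K" and k: "homomorphism L ?F A k"
      and ne: "k (trm_value ?F v s) \<noteq> k (trm_value ?F v t)"
      using free_algebra_separation[OF K] trm_value_in_universe[OF F v] st by metis
    have "range (\<lambda>x. k (v x)) \<subseteq> universe A" using v homomorphism_in[OF k] by auto
    then show False
      using ne homomorphism_trm_value[OF k F v] st id A by (simp add: satisfies_identity_iff)
  qed
qed

text \<open>Generators are sent to generators. The map is injective because whether two terms are
  identified depends only on the identities of \<open>K\<close>, not on the surrounding set of
  variables.\<close>

lemma free_algebra_embeds_omega:
  fixes X :: "nat set"
  assumes K: "\<forall>A\<in>K. is_algebra L A" and X: "terms L X \<noteq> {}"
  shows "embeds L (free_algebra L K X) (free_algebra_omega L K)"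
proof -
  let ?F = "free_algebra L K X" and ?O = "free_algebra L K (UNIV :: nat set)"
  let ?c = "\<lambda>t. free_congruence L K (UNIV :: nat set) `` {t}"
  have T: "terms L (UNIV :: nat set) \<noteq> {}" using X terms_mono by blast
  have O: "is_algebra L ?O" by (rule free_algebra_is_algebra[OF K T])
  define w where "w x = ?c (Var x)" for x
  have w: "range w \<subseteq> universe ?O" by (auto simp: w_def free_algebra_universe terms.Var)
  have id: "satisfies ?O ([], (s, t))"
    if "s \<in> terms L X" "t \<in> terms L X" "\<forall>A\<in>K. satisfies A ([], (s, t))" for s t
    by (rule free_algebra_satisfies_identity[OF K T]) (use that in \<open>auto intro: terms_mono\<close>)
  obtain k where k: "homomorphism L ?F ?O k"
    "\<And>t. t \<in> terms L X \<Longrightarrow> k (free_congruence L K X `` {t}) = trm_value ?O w t"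
    using free_algebra_lift[OF K X O w id] by blast
  have "homomorphism L (term_algebra L UNIV) ?O ?c"
    unfolding free_algebra_def
    by (rule quotient_map_homomorphism[OF term_algebra_is_algebra[OF T] free_congruence_congruence[OF K]])
  then have c: "?c t = trm_value ?O w t" if "t \<in> terms L UNIV" for t
    using term_homomorphism_eq[of L UNIV ?O ?c w t] that by (simp add: w_def)
  have "inj_on k (universe ?F)"
  proof (rule inj_onI)
    fix a b assume "a \<in> universe ?F" "b \<in> universe ?F" "k a = k b"
    then obtain s t where st: "s \<in> terms L X" "t \<in> terms L X"
      "a = free_congruence L K X `` {s}" "b = free_congruence L K X `` {t}"
      "trm_value ?O w s = trm_value ?O w t"
      using k(2) by (auto simp: free_algebra_universe)
    then have T: "s \<in> terms L UNIV" "t \<in> terms L UNIV" using terms_mono by blast+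
    then have "?c s = ?c t" using c st(5) by simp
    then show "a = b"
      using free_algebra_class_eq_iff[OF K T] free_algebra_class_eq_iff[OF K st(1,2)] st by simp
  qed
  then show ?thesis using k(1) by (auto simp: embeds_def free_algebra_omega_def)
qed

text \<open>A class is determined by the values of its terms at all assignments of \<open>X\<close>
  in members of \<open>K\<close>, and only finitely many such tables of values exist.\<close>

lemma free_algebra_finite:
  fixes X :: "nat set" and K :: "('f, 'a) algebra set"
  assumes K: "finite_algebra_set L K" and X: "finite X"
  shows "finite (universe (free_algebra L K X))"
proof -
  have KA: "\<forall>A\<in>K. is_algebra L A" and fin: "finite K" "\<And>A. A \<in> K \<Longrightarrow> finite (universe A)"
    using K by (auto simp: finite_algebra_set_def is_finite_algebra_def)
  let ?I = "SIGMA A:K. X \<rightarrow>\<^sub>E universe A"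
  let ?G = "(\<Pi>\<^sub>E (A, v)\<in>?I. universe A)"
  let ?c = "\<lambda>t. free_congruence L K X `` {t}"
  define \<Phi> where "\<Phi> t = (\<lambda>(A, v)\<in>?I. trm_value A v t)" for t :: "('f, nat) trm"
  \<comment> \<open>Assignments in \<open>?I\<close> are extensional, which keeps \<open>?I\<close>
    finite; to evaluate terms inside \<open>A\<close> they are completed by a fixed element
    \<open>a\<close> outside \<open>X\<close>.\<close>
  have total: "\<exists>w. range w \<subseteq> universe A \<and> (\<forall>x\<in>X. v x = w x)"
    if A: "A \<in> K" and v: "v \<in> X \<rightarrow>\<^sub>E universe A" for A v
  proof -
    obtain a where "a \<in> universe A" using KA A unfolding is_algebra_def by blast
    then show ?thesis using v by (intro exI[of _ "\<lambda>x. if x \<in> X then v x else a"]) auto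
  qed
  have "\<Phi> t \<in> ?G" if "t \<in> terms L X" for t
  proof -
    have "trm_value A v t \<in> universe A" if A: "A \<in> K" and v: "v \<in> X \<rightarrow>\<^sub>E universe A" for A v
    proof -
      obtain w where w: "range w \<subseteq> universe A" "\<forall>x\<in>X. v x = w x" using total[OF A v] by blast
      have "trm_value A v t = trm_value A w t"
        by (rule trm_value_cong[OF \<open>t \<in> terms L X\<close>]) (use w in auto)
      then show ?thesis
        using trm_value_in_universe[OF _ w(1) terms_mono[OF \<open>t \<in> terms L X\<close> subset_UNIV]] KA A by simp
    qed
    then show ?thesis by (auto simp: \<Phi>_def)
  qed
  moreover have "finite ?G"
    using fin X by (intro finite_PiE finite_SigmaI) auto
  ultimately have "finite (\<Phi> ` terms L X)" by (meson finite_subset image_subsetI)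
  moreover have "?c s = ?c t" if st: "s \<in> terms L X" "t \<in> terms L X" and eq: "\<Phi> s = \<Phi> t" for s t
    unfolding free_algebra_class_eq_iff[OF KA st] satisfies_identity_iff
  proof (intro ballI allI impI)
    fix A and v :: "nat \<Rightarrow> 'a" assume A: "A \<in> K" "range v \<subseteq> universe A"
    let ?v = "restrict v X"
    have "\<Phi> s (A, ?v) = \<Phi> t (A, ?v)" using eq by simp
    moreover have "(A, ?v) \<in> ?I" using A by auto
    ultimately have "trm_value A ?v s = trm_value A ?v t" by (simp add: \<Phi>_def)
    moreover have "trm_value A ?v u = trm_value A v u" if "u \<in> terms L X" for u
      by (rule trm_value_cong[OF that]) simp
    ultimately show "trm_value A v s = trm_value A v t" using st by simp
  qed
  \<comment> \<open>Equal tables give equal classes, so the set of classes is an image of the finite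
    set of tables.\<close>
  then have "?c ` terms L X = (\<lambda>p. ?c (inv_into (terms L X) \<Phi> p)) ` \<Phi> ` terms L X"
    unfolding image_image
    by (intro image_cong refl) (metis f_inv_into_f imageI inv_into_into)
  ultimately show ?thesis by (simp add: free_algebra_universe)
qed

section \<open>Uniqueness of minimal generating sets\<close>

lemma finite_algebra_separation:
  fixes A :: "('f, 'a) algebra" and M :: "('f, 'b) algebra set"
  assumes A: "is_finite_algebra L A" and M: "finite_algebra_set L M"
    and sat: "\<And>q. q \<in> quasi_identities L \<Longrightarrow> \<forall>C\<in>M. satisfies C q \<Longrightarrow> satisfies A q"
    and ab: "a \<in> universe A" "b \<in> universe A" "a \<noteq> b"
  shows "\<exists>C\<in>M. \<exists>h. homomorphism L A C h \<and> h a \<noteq> h b"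
proof (rule ccontr)
  txt \<open>The language may be infinite, so the full diagram of \<open>A\<close> is not available as a list of
    premises. But there are only finitely many maps into members of \<open>M\<close>, and one violated
    equation for each of them suffices.\<close>
  assume none: "\<not> ?thesis"
  let ?U = "universe A"
  have A': "is_algebra L A" "finite ?U" using A by (auto simp: is_finite_algebra_def)
  have M': "finite M" "\<And>C. C \<in> M \<Longrightarrow> finite (universe C)"
    using M by (auto simp: finite_algebra_set_def is_finite_algebra_def)
  obtain e :: "'a \<Rightarrow> nat" where e: "inj_on e ?U"
    using finite_imp_inj_to_nat_seg[OF A'(2)] by blast
  \<comment> \<open>All maps into \<open>C\<close> that separate \<open>a\<close> and
    \<open>b\<close> are collected, homomorphic or not; by \<open>none\<close>, each of them
    violates some operation.\<close>
  define G where "G C = {g \<in> ?U \<rightarrow>\<^sub>E universe C. g a \<noteq> g b}" for C :: "('f, 'b) algebra"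
  define I where "I = Sigma M G"
  have "finite (G C)" if "C \<in> M" for C
    unfolding G_def by (rule finite_subset[of _ "?U \<rightarrow>\<^sub>E universe C"]) (use A' M' that in \<open>auto intro: finite_PiE\<close>)
  then have fin: "finite I" unfolding I_def using M' by (intro finite_SigmaI)
  have "\<forall>p\<in>I. \<exists>r. fst r \<in> symbols L \<and> snd r \<in> args L A (fst r) \<and>
          snd p (oper A (fst r) (snd r)) \<noteq> oper (fst p) (fst r) (map (snd p) (snd r))"
  proof
    fix p assume p: "p \<in> I"
    then have "\<not> homomorphism L A (fst p) (snd p)" "snd p ` ?U \<subseteq> universe (fst p)"
      using none by (auto simp: I_def G_def)
    then show "\<exists>r. fst r \<in> symbols L \<and> snd r \<in> args L A (fst r) \<and>
          snd p (oper A (fst r) (snd r)) \<noteq> oper (fst p) (fst r) (map (snd p) (snd r))"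
      by (auto simp: homomorphism_def)
  qed
  then obtain \<phi> where \<phi>: "\<And>p. p \<in> I \<Longrightarrow> fst (\<phi> p) \<in> symbols L \<and> snd (\<phi> p) \<in> args L A (fst (\<phi> p)) \<and>
      snd p (oper A (fst (\<phi> p)) (snd (\<phi> p))) \<noteq> oper (fst p) (fst (\<phi> p)) (map (snd p) (snd (\<phi> p)))"
    by metis
  \<comment> \<open>\<open>e\<close> names the elements of \<open>A\<close> by variables;
    \<open>eqn r\<close> is the entry of the operation table of \<open>A\<close> at
    \<open>r\<close>, written as an equation.\<close>
  define eqn where "eqn r = (App (fst r) (map (Var \<circ> e) (snd r)), Var (e (oper A (fst r) (snd r))) :: ('f, nat) trm)"
    for r :: "'f \<times> 'a list"
  obtain ps where ps: "set ps = eqn ` \<phi> ` I" using fin finite_list by (metis finite_imageI)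
  define q where "q = (ps, (Var (e a) :: ('f, nat) trm, Var (e b) :: ('f, nat) trm))"
  have q: "q \<in> quasi_identities L"
    using \<phi> by (auto simp: q_def quasi_identities_def ps eqn_def args_def intro!: terms.intros)
  have "satisfies C q" if C: "C \<in> M" for C
    unfolding satisfies_def
  proof (intro allI impI)
    fix v :: "nat \<Rightarrow> 'b" assume v: "range v \<subseteq> universe C"
      and prem: "\<forall>(s, t)\<in>set (fst q). trm_value C v s = trm_value C v t"
    show "trm_value C v (fst (snd q)) = trm_value C v (snd (snd q))"
    proof (rule ccontr)
      assume ne: "\<not> ?thesis"
      \<comment> \<open>A valuation refuting \<open>q\<close> in \<open>C\<close> yields a map
        separating \<open>a\<close> and \<open>b\<close>. The table entry chosen for this map is a
        premise, yet the map violates it.\<close>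
      define g where "g = restrict (v \<circ> e) ?U"
      have I: "(C, g) \<in> I" using C v ab ne by (auto simp: I_def G_def g_def q_def)
      obtain f xs where fxs: "\<phi> (C, g) = (f, xs)" by fastforce
      have f: "f \<in> symbols L" "xs \<in> args L A f" "g (oper A f xs) \<noteq> oper C f (map g xs)"
        using \<phi>[OF I] fxs by auto
      have "eqn (f, xs) \<in> set (fst q)" using I fxs by (force simp: q_def ps)
      then have "oper C f (map (v \<circ> e) xs) = v (e (oper A f xs))"
        using prem by (auto simp: eqn_def o_def)
      moreover have "map g xs = map (v \<circ> e) xs" using f(2) by (auto simp: g_def args_def)
      moreover have "g (oper A f xs) = v (e (oper A f xs))"
        using is_algebra_oper[OF A'(1) f(1,2)] by (simp add: g_def)
      ultimately show False using f(3) by metis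
    qed
  qed
  then have "satisfies A q" using sat q by blast
  \<comment> \<open>The valuation undoing \<open>e\<close>, with default \<open>a\<close>. The
    premises are true equations of \<open>A\<close> under it, so validity of \<open>q\<close> forces
    \<open>a = b\<close>.\<close>
  moreover define v where "v n = (if n \<in> e ` ?U then inv_into ?U e n else a)" for n
  have ve: "v (e x) = x" if "x \<in> ?U" for x using that e by (simp add: v_def)
  have "range v \<subseteq> ?U" using ab by (auto simp: v_def inv_into_into e)
  moreover have "trm_value A v s = trm_value A v t" if st: "(s, t) \<in> set ps" for s t
  proof -
    obtain p where p: "p \<in> I" "(s, t) = eqn (\<phi> p)" using st ps by auto
    obtain f xs where fxs: "\<phi> p = (f, xs)" by fastforce
    have f: "f \<in> symbols L" "xs \<in> args L A f" using \<phi>[OF p(1)] fxs by auto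
    then have "map (trm_value A v) (map (Var \<circ> e) xs) = xs"
      by (auto simp: args_def ve subset_iff intro!: map_idI)
    then show ?thesis
      using p(2) fxs ve is_algebra_oper[OF A'(1) f] by (simp add: eqn_def)
  qed
  ultimately have "trm_value A v (fst (snd q)) = trm_value A v (snd (snd q))"
    unfolding satisfies_def q_def by auto
  then show False using ve ab by (simp add: q_def)
qed

section \<open>Comparing sizes of generating sets across types\<close>

text \<open>Only an inclusion: \<open>c\<close> may send different algebras to the same one, which
  is then counted once.\<close>

lemma sizes_image_le:
  assumes "finite M" "\<And>A. A \<in> M \<Longrightarrow> card (universe (c A)) = card (universe A)"
  shows "sizes (c ` M) \<subseteq># sizes M"
  using assms
proof (induction M rule: finite_induct)
  case (insert A M)
  then have IH: "sizes (c ` M) \<subseteq># sizes M" by simp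
  have "sizes (c ` insert A M) \<subseteq># add_mset (card (universe (c A))) (sizes (c ` M))"
    using insert(1) by (cases "c A \<in> c ` M") (auto simp: sizes_def insert_absorb)
  also have "\<dots> \<subseteq># sizes (insert A M)" using IH insert by (simp add: sizes_def)
  finally show ?case .
qed (simp add: sizes_def)

lemma sizes_Un_le: "finite M \<Longrightarrow> finite N \<Longrightarrow> sizes (M \<union> N) \<subseteq># sizes M + sizes N"
  unfolding sizes_def
  by (simp flip: image_mset_union, intro image_mset_subseteq_mono)
     (auto simp: subseteq_mset_def count_mset_set')

text \<open>Mutual embeddings between a member and its copy transfer every quasi-identity in both
  directions.\<close>

lemma finite_algebra_set_nat_copy:
  fixes M :: "('f, 'b) algebra set"
  assumes "finite_algebra_set L M"
  obtains N :: "('f, nat) algebra set" where "finite_algebra_set L N" "sizes N \<subseteq># sizes M"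
    "\<And>q. q \<in> quasi_identities L \<Longrightarrow> (\<forall>A\<in>N. satisfies A q) \<longleftrightarrow> (\<forall>A\<in>M. satisfies A q)"
proof -
  have M: "finite M" "\<And>A. A \<in> M \<Longrightarrow> is_finite_algebra L A"
    using assms by (auto simp: finite_algebra_set_def)
  have "\<forall>A\<in>M. \<exists>N :: ('f, nat) algebra. is_finite_algebra L N \<and>
      card (universe N) = card (universe A) \<and> embeds L A N \<and> embeds L N A"
    using isomorphic_nat_copy M(2) by blast
  from bchoice[OF this] obtain c :: "('f, 'b) algebra \<Rightarrow> ('f, nat) algebra" where
    c: "\<And>A. A \<in> M \<Longrightarrow> is_finite_algebra L (c A) \<and> card (universe (c A)) = card (universe A) \<and>
           embeds L A (c A) \<and> embeds L (c A) A"
    by blast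
  have "satisfies (c A) q \<longleftrightarrow> satisfies A q" if "A \<in> M" "q \<in> quasi_identities L" for A q
    using satisfies_embeds[of L "c A" A q] satisfies_embeds[of L A "c A" q] c[OF that(1)]
      M(2)[OF that(1)] that(2) by (auto simp: is_finite_algebra_def)
  then show ?thesis
    using c M sizes_image_le[of M c] by (intro that[of "c ` M"]) (auto simp: finite_algebra_set_def)
qed

lemma minimal_generating_set_algebra:
  assumes "minimal_generating_set L Q R" "A \<in> R"
  shows "is_algebra L A" "finite (universe A)" "is_finite_algebra L A"
  using assms by (auto simp: minimal_generating_set_def finite_algebra_set_def is_finite_algebra_def)

text \<open>The competitor is the union of \<open>M1\<close> and \<open>M2\<close>, kept as two sets
  because they may live on different types. Passing to copies on \<open>nat\<close> and uniting
  these can only shrink the multiset of sizes.\<close>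

lemma minimal_generating_set_le:
  fixes R :: "('f, 'a) algebra set" and M1 :: "('f, 'b) algebra set" and M2 :: "('f, 'c) algebra set"
  assumes R: "minimal_generating_set L Q R"
    and M: "finite_algebra_set L M1" "finite_algebra_set L M2"
    and sat: "\<And>q. q \<in> quasi_identities L \<Longrightarrow>
      (\<forall>A\<in>R. satisfies A q) \<longleftrightarrow> (\<forall>A\<in>M1. satisfies A q) \<and> (\<forall>A\<in>M2. satisfies A q)"
  shows "sizes R \<le> sizes M1 + sizes M2"
proof -
  obtain N1 :: "('f, nat) algebra set" where N1: "finite_algebra_set L N1" "sizes N1 \<subseteq># sizes M1"
    "\<And>q. q \<in> quasi_identities L \<Longrightarrow> (\<forall>A\<in>N1. satisfies A q) \<longleftrightarrow> (\<forall>A\<in>M1. satisfies A q)"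
    using finite_algebra_set_nat_copy[OF M(1)] by blast
  obtain N2 :: "('f, nat) algebra set" where N2: "finite_algebra_set L N2" "sizes N2 \<subseteq># sizes M2"
    "\<And>q. q \<in> quasi_identities L \<Longrightarrow> (\<forall>A\<in>N2. satisfies A q) \<longleftrightarrow> (\<forall>A\<in>M2. satisfies A q)"
    using finite_algebra_set_nat_copy[OF M(2)] by blast
  have N: "finite_algebra_set L (N1 \<union> N2)" using N1(1) N2(1) by (auto simp: finite_algebra_set_def)
  have "quasivariety L R = (quasivariety L (N1 \<union> N2) :: ('f, ('f, nat) trm set) algebra set)"
  proof (rule quasivariety_eqI)
    show "\<forall>A\<in>R. is_algebra L A" using minimal_generating_set_algebra[OF R] by blast
    show "\<forall>A\<in>N1 \<union> N2. is_algebra L A"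
      using N by (auto simp: finite_algebra_set_def is_finite_algebra_def)
    show "(\<forall>A\<in>R. satisfies A q) \<longleftrightarrow> (\<forall>A\<in>N1 \<union> N2. satisfies A q)" if "q \<in> quasi_identities L" for q
      using sat[OF that] N1(3)[OF that] N2(3)[OF that] by blast
  qed
  then have "sizes R \<le> sizes (N1 \<union> N2)"
    using R N by (auto simp: minimal_generating_set_def mle_iff_le)
  also have "sizes (N1 \<union> N2) \<subseteq># sizes M1 + sizes M2"
    using sizes_Un_le[of N1 N2] N1(1,2) N2(1,2)
    by (metis finite_algebra_set_def subset_mset.add_mono subset_mset.order_trans)
  then have "sizes (N1 \<union> N2) \<le> sizes M1 + sizes M2" by (rule subset_eq_imp_le_multiset)
  finally show ?thesis .
qed

lemma sizes_remove:
  "finite R \<Longrightarrow> A \<in> R \<Longrightarrow> sizes R = add_mset (card (universe A)) (sizes (R - {A}))"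
  unfolding sizes_def by (simp add: mset_set.remove)

text \<open>A member that embeds into another one inherits its quasi-identities. Deleting it would
  leave a generating set with strictly smaller sizes.\<close>

lemma minimal_generating_set_antichain:
  assumes R: "minimal_generating_set L Q R" and AB: "A \<in> R" "B \<in> R" "embeds L A B"
  shows "A = B"
proof (rule ccontr)
  assume "A \<noteq> B"
  have fin: "finite_algebra_set L R" using R by (simp add: minimal_generating_set_def)
  \<comment> \<open>Nothing replaces \<open>A\<close>, so the second part of the competitor is
    empty.\<close>
  have "sizes R \<le> sizes (R - {A}) + sizes ({} :: ('a, nat) algebra set)"
  proof (rule minimal_generating_set_le[OF R])
    fix q assume "q \<in> quasi_identities L"
    then have "satisfies B q \<Longrightarrow> satisfies A q"
      using satisfies_embeds[OF AB(3)] minimal_generating_set_algebra[OF R AB(1)] by blast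
    then show "(\<forall>A\<in>R. satisfies A q) \<longleftrightarrow> (\<forall>A\<in>R - {A}. satisfies A q) \<and>
        (\<forall>A\<in>({} :: ('a, nat) algebra set). satisfies A q)"
      using AB(2) \<open>A \<noteq> B\<close> by blast
  qed (use fin in \<open>auto simp: finite_algebra_set_def\<close>)
  moreover have "sizes R = add_mset (card (universe A)) (sizes (R - {A}))"
    using fin AB(1) by (intro sizes_remove) (auto simp: finite_algebra_set_def)
  ultimately show False by (simp add: sizes_def)
qed

text \<open>Otherwise \<open>A\<close> could be replaced by its proper homomorphic images in members of \<open>R'\<close>: they
  are smaller, lie in \<open>Q\<close>, and jointly separate the points of \<open>A\<close>.\<close>

lemma minimal_generating_set_embeds:
  fixes R :: "('f, 'a) algebra set" and R' :: "('f, 'b) algebra set"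
  assumes R: "minimal_generating_set L Q R" and R': "minimal_generating_set L Q R'" and A: "A \<in> R"
  shows "\<exists>C\<in>R'. embeds L A C"
proof (rule ccontr)
  assume none: "\<not> ?thesis"
  have fin: "finite_algebra_set L R" "finite_algebra_set L R'"
    using R R' by (auto simp: minimal_generating_set_def)
  have algs: "\<forall>A\<in>R. is_algebra L A" "\<forall>A\<in>R'. is_algebra L A"
    using minimal_generating_set_algebra[OF R] minimal_generating_set_algebra[OF R'] by blast+
  have Q: "(quasivariety L R :: ('f, ('f, nat) trm set) algebra set) = quasivariety L R'"
    using R R' by (simp add: minimal_generating_set_def)
  note A_alg = minimal_generating_set_algebra[OF R A]
  define im where "im C h = \<lparr>universe = h ` universe A, oper = oper C\<rparr>"
    for C :: "('f, 'b) algebra" and h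
  \<comment> \<open>The replacement for \<open>A\<close>: all its homomorphic images inside members
    of \<open>R'\<close>.\<close>
  define M where "M = {im C h | C h. C \<in> R' \<and> homomorphism L A C h}"
  have im: "subalgebra L (im C h) C" if "homomorphism L A C h" for C h
    unfolding im_def by (rule subalgebra_image[OF that A_alg(1)])
  have small: "card (universe D) < card (universe A)" if D: "D \<in> M" for D
  proof -
    obtain C h where Ch: "D = im C h" "C \<in> R'" "homomorphism L A C h" using D by (auto simp: M_def)
    then have "\<not> inj_on h (universe A)" using none by (auto simp: embeds_def)
    then show ?thesis
      using A_alg(2) Ch(1) card_image_le[of "universe A" h] eq_card_imp_inj_on[of "universe A" h]
      by (force simp: im_def)
  qed
  \<comment> \<open>There may be infinitely many \<open>h\<close>, as values outside
    \<open>universe A\<close> are arbitrary, but \<open>im C h\<close> depends only on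
    \<open>C\<close> and on a subset of its finite universe.\<close>
  have "M \<subseteq> (\<Union>C\<in>R'. (\<lambda>U. \<lparr>universe = U, oper = oper C\<rparr>) ` Pow (universe C))"
    by (auto simp: M_def im_def homomorphism_def)
  moreover have "finite \<dots>"
    using fin(2) by (auto simp: finite_algebra_set_def is_finite_algebra_def)
  ultimately have "finite M" by (rule finite_subset)
  moreover have "is_finite_algebra L D" if "D \<in> M" for D
    using that im A_alg(2) by (auto simp: M_def is_finite_algebra_def subalgebra_def) (auto simp: im_def)
  ultimately have M: "finite_algebra_set L M" by (simp add: finite_algebra_set_def)
  \<comment> \<open>The set \<open>R\<close> with \<open>A\<close> replaced by \<open>M\<close>
    still has the quasi-identities of \<open>R\<close>: those of \<open>R\<close> hold in
    subalgebras of members of \<open>R'\<close>, and those of \<open>M\<close> hold in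
    \<open>A\<close> by separation.\<close>
  have "sizes R \<le> sizes (R - {A}) + sizes M"
  proof (rule minimal_generating_set_le[OF R _ M])
    show "finite_algebra_set L (R - {A})" using fin by (auto simp: finite_algebra_set_def)
    fix q assume q: "q \<in> quasi_identities L"
    have "satisfies D q" if RS: "\<forall>A\<in>R. satisfies A q" and D: "D \<in> M" for D
    proof -
      obtain C h where C: "D = im C h" "C \<in> R'" "homomorphism L A C h"
        using D by (auto simp: M_def)
      then have "satisfies C q"
        using quasivariety_subset_satisfies[OF algs _ q] Q RS by blast
      then show ?thesis
        using C im[OF C(3)] subalgebra_embeds satisfies_embeds q unfolding subalgebra_def by blast
    qed
    moreover have "satisfies A q" if sat: "\<forall>D\<in>M. satisfies D q"
      unfolding satisfies_def
    proof (intro allI impI)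
      fix v :: "nat \<Rightarrow> 'a" assume v: "range v \<subseteq> universe A"
        and prem: "\<forall>(s, t)\<in>set (fst q). trm_value A v s = trm_value A v t"
      let ?a = "trm_value A v (fst (snd q))" and ?b = "trm_value A v (snd (snd q))"
      have T: "fst (snd q) \<in> terms L UNIV" "snd (snd q) \<in> terms L UNIV"
        using q by (auto simp: quasi_identities_def)
      show "?a = ?b"
      proof (rule ccontr)
        assume "?a \<noteq> ?b"
        moreover have "?a \<in> universe A" "?b \<in> universe A"
          using T trm_value_in_universe[OF A_alg(1) v] by auto
        moreover have "satisfies A r" if "r \<in> quasi_identities L" "\<forall>C\<in>R'. satisfies C r" for r
          using quasivariety_subset_satisfies[OF algs(2,1) _ that _] Q A by blast
        \<comment> \<open>A homomorphism separating the two sides of the conclusion carries the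
          refuting valuation to one in the image \<open>im C h\<close>, a member of
          \<open>M\<close>.\<close>
        ultimately obtain C h where C: "C \<in> R'" "homomorphism L A C h" "h ?a \<noteq> h ?b"
          using finite_algebra_separation[OF A_alg(3) fin(2)] by metis
        have h: "homomorphism L A (im C h) h"
          using C(2) by (auto simp: homomorphism_def im_def)
        have hv: "h (trm_value A v t) = trm_value (im C h) (\<lambda>x. h (v x)) t"
          if "t \<in> terms L UNIV" for t by (rule homomorphism_trm_value[OF h A_alg(1) v that])
        have "\<forall>(s, t)\<in>set (fst q).
            trm_value (im C h) (\<lambda>x. h (v x)) s = trm_value (im C h) (\<lambda>x. h (v x)) t"
        proof (intro ballI, clarify)
          fix s t assume st: "(s, t) \<in> set (fst q)"
          then have "s \<in> terms L UNIV" "t \<in> terms L UNIV" using q by (auto simp: quasi_identities_def)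
          then show "trm_value (im C h) (\<lambda>x. h (v x)) s = trm_value (im C h) (\<lambda>x. h (v x)) t"
            using hv[of s] hv[of t] prem st by auto
        qed
        moreover have "satisfies (im C h) q" using sat C by (auto simp: M_def)
        moreover have "range (\<lambda>x. h (v x)) \<subseteq> universe (im C h)" using v homomorphism_in[OF h] by auto
        ultimately have "trm_value (im C h) (\<lambda>x. h (v x)) (fst (snd q)) =
            trm_value (im C h) (\<lambda>x. h (v x)) (snd (snd q))"
          unfolding satisfies_def by blast
        then show False using C(3) hv[OF T(1)] hv[OF T(2)] by simp
      qed
    qed
    ultimately show "(\<forall>A\<in>R. satisfies A q) \<longleftrightarrow>
        (\<forall>A\<in>R - {A}. satisfies A q) \<and> (\<forall>A\<in>M. satisfies A q)" by blast
  qed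
  moreover have "sizes R = sizes (R - {A}) + {#card (universe A)#}"
    using fin(1) A sizes_remove by (fastforce simp: finite_algebra_set_def)
  \<comment> \<open>In the multiset order a single entry exceeds any number of strictly smaller
    ones, so the number of images is irrelevant.\<close>
  moreover have "sizes M < {#card (universe A)#}"
    using small by (intro ex_gt_imp_less_multiset) (auto simp: sizes_def \<open>finite M\<close>)
  ultimately show False by simp
qed

text \<open>Going from \<open>R\<close> to \<open>R'\<close> and back embeds each member into a
  member of its own set, which is the same member by the antichain property; hence \<open>f\<close>
  and \<open>g\<close> are mutually inverse. Mutually embeddable finite algebras have equal size, so
  the embeddings are onto.\<close>

lemma minimal_generating_set_unique:
  fixes R :: "('f, 'a) algebra set" and R' :: "('f, 'b) algebra set"
  assumes R: "minimal_generating_set L Q R" and R': "minimal_generating_set L Q R'"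
  shows "\<exists>h. bij_betw h R R' \<and> (\<forall>A\<in>R. isomorphic L A (h A))"
proof -
  obtain f where f: "\<And>A. A \<in> R \<Longrightarrow> f A \<in> R' \<and> embeds L A (f A)"
    using minimal_generating_set_embeds[OF R R'] by metis
  obtain g where g: "\<And>B. B \<in> R' \<Longrightarrow> g B \<in> R \<and> embeds L B (g B)"
    using minimal_generating_set_embeds[OF R' R] by metis
  have gf: "g (f A) = A" if "A \<in> R" for A
    using minimal_generating_set_antichain[OF R that] f[OF that] g embeds_trans by metis
  have fg: "f (g B) = B" if "B \<in> R'" for B
    using minimal_generating_set_antichain[OF R' that] g[OF that] f embeds_trans by metis
  have "bij_betw f R R'" by (rule bij_betw_byWitness[of _ g]) (use f g gf fg in auto)
  moreover have "isomorphic L A (f A)" if "A \<in> R" for A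
  proof (rule embeds_imp_isomorphic)
    show "embeds L A (f A)" using f that by blast
    show "finite (universe (f A))" using minimal_generating_set_algebra(2)[OF R'] f that by blast
    show "card (universe (f A)) \<le> card (universe A)"
      using embeds_card_le[of L "f A" A] g[of "f A"] f[OF that] gf[OF that]
        minimal_generating_set_algebra(2)[OF R that] by simp
  qed
  ultimately show ?thesis by blast
qed

section \<open>Correctness of the procedure\<close>

text \<open>Each iteration that changes the algebra passes to a proper subalgebra still mapping onto
  \<open>A\<close>, so the cardinality is a termination measure and the rest is a loop
  invariant.\<close>

lemma SubPreHom_loop:
  fixes A :: "('f, 'a) algebra" and B :: "('f, 'b) algebra"
  assumes sph: "is_SubPreHom L sph" and A: "is_finite_algebra L A" and B: "is_finite_algebra L B"
    and im: "is_homomorphic_image L A B"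
  obtains C where "while_option (\<lambda>B. sph A B \<noteq> B) (sph A) B = Some C"
    "subalgebra L C B" "is_homomorphic_image L A C"
proof -
  define P where "P C \<longleftrightarrow> subalgebra L C B \<and> is_homomorphic_image L A C" for C
  have step: "P (sph A C) \<and> card (universe (sph A C)) < card (universe C)"
    if "P C" "sph A C \<noteq> C" for C
  proof -
    have fin: "finite (universe C)"
      using that B by (auto simp: P_def subalgebra_def is_finite_algebra_def intro: finite_subset)
    then have "is_finite_algebra L C" using that by (auto simp: P_def subalgebra_def is_finite_algebra_def)
    then have "proper_subalgebra L (sph A C) C \<and> is_homomorphic_image L A (sph A C)"
      using sph A that(2) unfolding is_SubPreHom_def by metis
    then have sub: "subalgebra L (sph A C) C" "universe (sph A C) \<noteq> universe C"
      and "is_homomorphic_image L A (sph A C)" by (auto simp: proper_subalgebra_def)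
    then have "P (sph A C)" using subalgebra_trans that(1) unfolding P_def by blast
    moreover have "universe (sph A C) \<subset> universe C" using sub by (auto simp: subalgebra_def)
    ultimately show ?thesis using fin by (auto intro: psubset_card_mono)
  qed
  have P: "P B" using B im by (auto simp: P_def is_finite_algebra_def subalgebra_refl)
  obtain C where C: "while_option (\<lambda>B. sph A B \<noteq> B) (sph A) B = Some C"
    using measure_while_option_Some[of P "\<lambda>B. sph A B \<noteq> B" "sph A" "\<lambda>C. card (universe C)" B] step P
    by blast
  moreover have "P C" by (rule while_option_rule[where P = P, OF _ C P]) (use step in blast)
  ultimately show ?thesis using that by (auto simp: P_def)
qed

text \<open>The least \<open>m\<close> exists because \<open>card (universe A)\<close> generators
  suffice: they can be sent onto all elements of \<open>A\<close>.\<close>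

lemma Free_properties:
  fixes D :: "('f, 'a) algebra set"
  assumes D: "finite_algebra_set L D" and A: "A \<in> D"
  obtains X :: "nat set" where "Free L A D = free_algebra L D X" "terms L X \<noteq> {}"
    "is_finite_algebra L (Free L A D)" "is_homomorphic_image L A (Free L A D)"
proof -
  have DA: "\<forall>A\<in>D. is_algebra L A" and A': "is_algebra L A" "finite (universe A)"
    using D A by (auto simp: finite_algebra_set_def is_finite_algebra_def)
  define P where "P m \<longleftrightarrow> (if has_constant L then 0 else 1) \<le> m \<and>
                 is_homomorphic_image L A (free_algebra_fin L D m)" for m :: nat
  define n where "n = card (universe A)"
  have n: "n \<ge> 1" using A' by (auto simp: n_def is_algebra_def Suc_le_eq card_gt_0_iff)
  obtain e where e: "bij_betw e {..<n} (universe A)"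
    using ex_bij_betw_nat_finite[OF A'(2)] by (auto simp: n_def atLeast0LessThan)
  \<comment> \<open>Enumerates \<open>A\<close> on the first \<open>n\<close> variables; the default
    \<open>e 0\<close> exists since \<open>n\<close> is positive.\<close>
  define w where "w i = e (if i < n then i else 0)" for i
  have w: "range w \<subseteq> universe A" using e n by (auto simp: w_def bij_betw_def)
  have T: "terms L {..<n} \<noteq> {}" using n terms.Var[of 0 "{..<n}" L] by auto
  obtain k where k: "homomorphism L (free_algebra L D {..<n}) A k"
    "\<And>t. t \<in> terms L {..<n} \<Longrightarrow> k (free_congruence L D {..<n} `` {t}) = trm_value A w t"
    using free_algebra_lift[OF DA T A'(1) w] A by blast
  have "universe A \<subseteq> k ` universe (free_algebra L D {..<n})"
  proof
    fix a assume "a \<in> universe A"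
    then obtain i where i: "i < n" "e i = a"
      using e by (metis bij_betw_imp_surj_on imageE lessThan_iff)
    then have "a = k (free_congruence L D {..<n} `` {Var i})"
      using k(2)[of "Var i"] by (simp add: terms.Var w_def)
    then show "a \<in> k ` universe (free_algebra L D {..<n})"
      using i(1) by (auto simp: free_algebra_universe intro!: imageI terms.Var)
  qed
  then have "P n"
    using n k(1) by (auto simp: P_def is_homomorphic_image_def free_algebra_fin_def homomorphism_def)
  then have PL: "P (LEAST m. P m)" by (rule LeastI)
  define X where "X = {..<(LEAST m. P m)}"
  have F: "Free L A D = free_algebra L D X"
    by (simp add: Free_def X_def P_def[abs_def] free_algebra_fin_def)
  \<comment> \<open>This is where the starting value of \<open>m\<close> matters: without constants
    there must be at least one generator.\<close>
  have "terms L X \<noteq> {}"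
  proof (cases "has_constant L")
    case True
    then obtain f where "f \<in> symbols L" "arity L f = 0" by (auto simp: has_constant_def)
    then have "App f [] \<in> terms L X" by (intro terms.App) auto
    then show ?thesis by blast
  next
    case False
    then have "0 \<in> X" using PL by (auto simp: P_def X_def)
    then show ?thesis using terms.Var[of 0 X L] by blast
  qed
  moreover have "is_homomorphic_image L A (Free L A D)"
    using PL unfolding F by (simp add: P_def X_def free_algebra_fin_def)
  moreover have "is_finite_algebra L (Free L A D)"
    unfolding F is_finite_algebra_def
    using free_algebra_is_algebra[OF DA \<open>terms L X \<noteq> {}\<close>] free_algebra_finite[OF D, of X]
    by (simp add: X_def)
  ultimately show ?thesis using that F by blast
qed

text \<open>A valuation refuting a quasi-identity in the free algebra refutes it in some \<open>A \<in> D\<close> after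
  composition with a homomorphism; as \<open>F A\<close> satisfies the identities of \<open>D\<close>, that homomorphism
  lifts along \<open>F A \<rightarrow> A\<close>.\<close>

lemma free_algebra_omega_satisfies_iff:
  fixes D :: "('f, 'a) algebra set" and F :: "('f, 'a) algebra \<Rightarrow> ('f, 'b) algebra"
  assumes D: "\<forall>A\<in>D. is_algebra L A"
    and F: "\<And>A. A \<in> D \<Longrightarrow> is_algebra L (F A)" "\<And>A. A \<in> D \<Longrightarrow> embeds L (F A) (free_algebra_omega L D)"
      "\<And>A. A \<in> D \<Longrightarrow> is_homomorphic_image L A (F A)"
    and q: "q \<in> quasi_identities L"
  shows "satisfies (free_algebra_omega L D) q \<longleftrightarrow> (\<forall>A\<in>D. satisfies (F A) q)"
proof
  assume "satisfies (free_algebra_omega L D) q"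
  then show "\<forall>A\<in>D. satisfies (F A) q" using satisfies_embeds F q by blast
next
  assume sat: "\<forall>A\<in>D. satisfies (F A) q"
  let ?O = "free_algebra L D (UNIV :: nat set)"
  let ?c = "\<lambda>t. free_congruence L D (UNIV :: nat set) `` {t}"
  have T: "terms L (UNIV :: nat set) \<noteq> {}" using terms.Var[of 0 UNIV L] by auto
  have O: "is_algebra L ?O" by (rule free_algebra_is_algebra[OF D T])
  have "satisfies ?O q"
    unfolding satisfies_def
  proof (intro allI impI)
    fix v :: "nat \<Rightarrow> _" assume v: "range v \<subseteq> universe ?O"
      and prem: "\<forall>(s, t)\<in>set (fst q). trm_value ?O v s = trm_value ?O v t"
    let ?a = "trm_value ?O v (fst (snd q))" and ?b = "trm_value ?O v (snd (snd q))"
    have qT: "fst (snd q) \<in> terms L UNIV" "snd (snd q) \<in> terms L UNIV"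
      using q by (auto simp: quasi_identities_def)
    have ab: "?a \<in> universe ?O" "?b \<in> universe ?O"
      using trm_value_in_universe[OF O v] qT by auto
    show "?a = ?b"
    proof (rule ccontr)
      assume ab_ne: "?a \<noteq> ?b"
      obtain A w k where A: "A \<in> D" and w: "range w \<subseteq> universe A"
        and k: "\<And>t. t \<in> terms L UNIV \<Longrightarrow> k (?c t) = trm_value A w t" "k ?a \<noteq> k ?b"
        by (rule free_algebra_separation[OF D ab ab_ne]) (rule that; simp)
      obtain g where g: "homomorphism L (F A) A g" "g ` universe (F A) = universe A"
        using F(3)[OF A] by (auto simp: is_homomorphic_image_def)
      \<comment> \<open>Preimages under the surjection \<open>g\<close> are chosen for the
        generators; freeness then extends \<open>w'\<close> to the homomorphism
        \<open>k'\<close>.\<close>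
      have "\<exists>y. y \<in> universe (F A) \<and> g y = w x" for x
        using w g(2) by (metis imageE range_subsetD)
      then obtain w' where w': "\<And>x. w' x \<in> universe (F A)" "\<And>x. g (w' x) = w x" by metis
      then have rw': "range w' \<subseteq> universe (F A)" by auto
      have id: "satisfies (F A) ([], (s, t))"
        if "s \<in> terms L UNIV" "t \<in> terms L UNIV" "\<forall>A\<in>D. satisfies A ([], (s, t))" for s t
      proof (rule satisfies_embeds[OF F(2)[OF A] F(1)[OF A]])
        show "([], (s, t)) \<in> quasi_identities L" using that by (auto simp: quasi_identities_def)
        show "satisfies (free_algebra_omega L D) ([], (s, t))"
          unfolding free_algebra_omega_def by (rule free_algebra_satisfies_identity[OF D T that])
      qed
      obtain k' where k': "homomorphism L ?O (F A) k'"
        "\<And>t. t \<in> terms L UNIV \<Longrightarrow> k' (?c t) = trm_value (F A) w' t"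
        using free_algebra_lift[OF D T F(1)[OF A] rw' id] by blast
      \<comment> \<open>Both sides send the class of \<open>t\<close> to the value of
        \<open>t\<close> under \<open>w\<close>. Since \<open>k\<close> separates \<open>?a\<close>
        and \<open>?b\<close>, so does \<open>k'\<close>.\<close>
      have "g (k' x) = k x" if x: "x \<in> universe ?O" for x
      proof -
        obtain t where t: "t \<in> terms L UNIV" "x = ?c t" using x by (auto simp: free_algebra_universe)
        then show ?thesis
          using homomorphism_trm_value[OF g(1) F(1)[OF A] rw' t(1)] k(1) k'(2) w'(2) by simp
      qed
      then have ne: "k' ?a \<noteq> k' ?b" using k(2) ab by metis
      have kv: "k' (trm_value ?O v t) = trm_value (F A) (\<lambda>x. k' (v x)) t" if "t \<in> terms L UNIV" for t
        by (rule homomorphism_trm_value[OF k'(1) O v that])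
      have "\<forall>(s, t)\<in>set (fst q).
          trm_value (F A) (\<lambda>x. k' (v x)) s = trm_value (F A) (\<lambda>x. k' (v x)) t"
      proof (intro ballI, clarify)
        fix s t assume st: "(s, t) \<in> set (fst q)"
        then have "s \<in> terms L UNIV" "t \<in> terms L UNIV" using q by (auto simp: quasi_identities_def)
        then show "trm_value (F A) (\<lambda>x. k' (v x)) s = trm_value (F A) (\<lambda>x. k' (v x)) t"
          using kv[of s] kv[of t] prem st by auto
      qed
      moreover have "range (\<lambda>x. k' (v x)) \<subseteq> universe (F A)" using v homomorphism_in[OF k'(1)] by auto
      ultimately have "trm_value (F A) (\<lambda>x. k' (v x)) (fst (snd q)) =
          trm_value (F A) (\<lambda>x. k' (v x)) (snd (snd q))"
        using sat A unfolding satisfies_def by blast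
      then show False using ne kv[OF qT(1)] kv[OF qT(2)] by simp
    qed
  qed
  then show "satisfies (free_algebra_omega L D) q" by (simp add: free_algebra_omega_def)
qed

text \<open>The two algebras are literally equal: both are quotients of the same term algebra, and
  the congruences agree because identities are quasi-identities without premises.\<close>

lemma free_algebra_omega_cong:
  fixes K :: "('f, 'a) algebra set" and D :: "('f, 'b) algebra set"
  assumes K: "\<forall>A\<in>K. is_algebra L A" and D: "\<forall>A\<in>D. is_algebra L A"
    and Q: "(quasivariety L K :: ('f, ('f, nat) trm set) algebra set) = quasivariety L D"
  shows "free_algebra_omega L K = free_algebra_omega L D"
proof -
  have "(s, t) \<in> free_congruence L K UNIV \<longleftrightarrow> (s, t) \<in> free_congruence L D UNIV"
    for s t :: "('f, nat) trm"
  proof -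
    have "(\<forall>A\<in>K. satisfies A q) \<longleftrightarrow> (\<forall>A\<in>D. satisfies A q)" if "q \<in> quasi_identities L" for q
      using quasivariety_subset_satisfies[OF K D _ that] quasivariety_subset_satisfies[OF D K _ that] Q
      by blast
    from this[of "([], (s, t))"] show ?thesis
      unfolding free_congruence_iff[OF K] free_congruence_iff[OF D]
      by (auto simp: quasi_identities_def)
  qed
  then have "free_congruence L K UNIV = free_congruence L D (UNIV :: nat set)" by auto
  then show ?thesis by (simp add: free_algebra_omega_def free_algebra_def)
qed

theorem theorem5p4:
  fixes L :: "'f language"
    and K :: "('f, 'a) algebra set"
    and mgs1 :: "('f, 'a) algebra set \<Rightarrow> ('f, 'd) algebra set"
    and sph :: "('f, 'd) algebra \<Rightarrow> ('f, ('f, nat) trm set) algebra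
                \<Rightarrow> ('f, ('f, nat) trm set) algebra"
    and mgs2 :: "('f, ('f, nat) trm set) algebra set \<Rightarrow> ('f, 'e) algebra set"
  assumes "finite_algebra_set L K"
    and "is_MinGenSet L mgs1"
    and "is_SubPreHom L sph"
    and "is_MinGenSet L mgs2"
  shows "\<exists>R. AdmAlgs L mgs1 sph mgs2 K = Some R \<and>
           minimal_generating_set L (quasivariety L {free_algebra_omega L K}) R \<and>
           (\<forall>R' :: ('f, 'r) algebra set.
              minimal_generating_set L (quasivariety L {free_algebra_omega L K}) R' \<longrightarrow>
              (\<exists>h. bij_betw h R R' \<and> (\<forall>A\<in>R. isomorphic L A (h A))))"
proof -
  define D where "D = mgs1 K"
  have K: "\<forall>A\<in>K. is_algebra L A"
    using assms(1) by (auto simp: finite_algebra_set_def is_finite_algebra_def)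
  have Dm: "minimal_generating_set L (quasivariety L K) D"
    using assms(1,2) by (simp add: is_MinGenSet_def D_def)
  then have D: "finite_algebra_set L D" by (simp add: minimal_generating_set_def)
  have DA: "\<forall>A\<in>D. is_algebra L A" using minimal_generating_set_algebra(1)[OF Dm] by blast
  \<comment> \<open>The properties of the loop result from which the generated quasivariety is
    computed: finiteness, an embedding into the free algebra on countably many generators, and a
    homomorphism onto \<open>A\<close>.\<close>
  have "\<forall>A\<in>D. \<exists>C. while_option (\<lambda>B. sph A B \<noteq> B) (sph A) (Free L A D) = Some C \<and>
      is_finite_algebra L C \<and> embeds L C (free_algebra_omega L D) \<and> is_homomorphic_image L A C"
  proof
    fix A assume A: "A \<in> D"
    obtain X :: "nat set" where X: "Free L A D = free_algebra L D X" "terms L X \<noteq> {}"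
      and F: "is_finite_algebra L (Free L A D)" "is_homomorphic_image L A (Free L A D)"
      using Free_properties[OF D A] by blast
    obtain C where C: "while_option (\<lambda>B. sph A B \<noteq> B) (sph A) (Free L A D) = Some C"
      "subalgebra L C (Free L A D)" "is_homomorphic_image L A C"
      using SubPreHom_loop[OF assms(3) minimal_generating_set_algebra(3)[OF Dm A] F] by blast
    have "embeds L C (free_algebra_omega L D)"
      using embeds_trans[OF subalgebra_embeds[OF C(2)]] free_algebra_embeds_omega[OF DA X(2)] X(1) by simp
    moreover have "is_finite_algebra L C"
      using C(2) F(1) by (auto simp: subalgebra_def is_finite_algebra_def intro: finite_subset)
    ultimately show "\<exists>C. while_option (\<lambda>B. sph A B \<noteq> B) (sph A) (Free L A D) = Some C \<and>
      is_finite_algebra L C \<and> embeds L C (free_algebra_omega L D) \<and> is_homomorphic_image L A C"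
      using C by blast
  qed
  from bchoice[OF this] obtain F where loop: "\<And>A. A \<in> D \<Longrightarrow>
      while_option (\<lambda>B. sph A B \<noteq> B) (sph A) (Free L A D) = Some (F A)"
    and F: "\<And>A. A \<in> D \<Longrightarrow> is_finite_algebra L (F A)"
      "\<And>A. A \<in> D \<Longrightarrow> embeds L (F A) (free_algebra_omega L D)"
      "\<And>A. A \<in> D \<Longrightarrow> is_homomorphic_image L A (F A)" by blast
  have FA: "\<And>A. A \<in> D \<Longrightarrow> is_algebra L (F A)" using F(1) by (simp add: is_finite_algebra_def)
  have "(\<lambda>A. while_option (\<lambda>B. sph A B \<noteq> B) (sph A) (Free L A D)) ` D = Some ` F ` D"
    unfolding image_image by (rule image_cong) (use loop in auto)
  then have Adm: "AdmAlgs L mgs1 sph mgs2 K = Some (mgs2 (F ` D))"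
    by (auto simp: AdmAlgs_def Let_def D_def[symmetric] image_image)
  \<comment> \<open>The procedure works with free algebras of \<open>D\<close>, the claim concerns
    that of \<open>K\<close>; both sets generate the same quasivariety.\<close>
  have \<Omega>: "free_algebra_omega L K = free_algebra_omega L D"
    using Dm by (intro free_algebra_omega_cong K DA) (simp add: minimal_generating_set_def)
  have "is_algebra L (free_algebra_omega L D)"
    unfolding free_algebra_omega_def using terms.Var[of 0 UNIV L]
    by (intro free_algebra_is_algebra DA) auto
  then have "quasivariety L (F ` D) =
      (quasivariety L {free_algebra_omega L K} :: ('f, ('f, nat) trm set) algebra set)"
    unfolding \<Omega> using free_algebra_omega_satisfies_iff[OF DA FA F(2,3)] FA
    by (intro quasivariety_eqI) auto
  moreover have "finite_algebra_set L (F ` D)" using D F(1) by (auto simp: finite_algebra_set_def)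
  ultimately have R: "minimal_generating_set L (quasivariety L {free_algebra_omega L K}) (mgs2 (F ` D))"
    using assms(4) by (auto simp: is_MinGenSet_def)
  show ?thesis using Adm R minimal_generating_set_unique[OF R] by blast
qed

end
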